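(* Let $K\ge 2$ and consider the symmetric $K$-user fully connected Gaussian interference channel with output feedback, with $\mathsf{INR}=\mathsf{SNR}$. Then the per-user number of degrees of freedom is $1/K$, i.e. $$\limsup_{\mathsf{SNR}\to\infty}\frac{R_{\mathrm{sym}}(\mathsf{SNR},\mathsf{SNR})}{\frac12\log\mathsf{SNR}}=\frac1K .$$
   Context: Channel model: there are $K$ transmitters and $K$ receivers; transmitter $k$ has a message $W_k$ for receiver $k$, the messages being independent and uniformly distributed. At time $t$ receiver $k$ observes the real signal $$y_k(t)=\sqrt{\mathsf{SNR}}\,x_k(t)+\sum_{i\neq k}\sqrt{\mathsf{INR}}\,x_i(t)+z_k(t),$$ where $x_i(t)\in\mathbb{R}$ is the input of transmitter $i$, the noises $z_k(t)\sim\mathcal N(0,1)$ are independent over $k$ and $t$ and independent of the messages, and $\mathsf{SNR},\mathsf{INR}>0$ are constants. Inputs have power constraint $\mathbb E[x_k^2]\le 1$ (average power over the block: $\frac1T\sum_{t=1}^T\mathbb E[x_k(t)^2]\le 1$ for block length $T$). Output feedback: each transmitter has causal noiseless feedback from its own receiver, i.e. $x_k(t)=g_{kt}(W_k,y_k(1),\dots,y_k(t-1))$. Receiver $k$ decodes $W_k$ from $y_k(1),\dots,y_k(T)$. A rate tuple $(R_1,\dots,R_K)$ (bits per channel use; $\log$ is base 2) is achievable if there is a family of such codes with block length $T$, with message set of user $k$ of size at least $2^{TR_k}$, whose average decoding error probability tends to $0$ for all users as $T\to\infty$. $R_{\mathrm{sym}}(\mathsf{SNR},\mathsf{INR})$ denotes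 the supremum of $R$ such that $(R,\dots,R)$ is achievable. *)

theory Defs
  imports "HOL-Probability.Probability"
begin

text \<open>
  Users are \<open>{..<K}\<close>, channel uses \<open>{..<T}\<close>, and the messages of user \<open>k\<close> are
  \<open>{..<msgs C k}\<close>. A block of outputs of one receiver is an element of
  \<open>\<Pi>\<^sub>M s\<in>{..<t}. borel\<close>, i.e. a function that is \<open>undefined\<close> outside \<open>{..<t}\<close>.
\<close>

record fb_code =
  msgs :: "nat \<Rightarrow> nat"
  enc  :: "nat \<Rightarrow> nat \<Rightarrow> nat \<Rightarrow> (nat \<Rightarrow> real) \<Rightarrow> real"  \<comment> \<open>user, time, message, past outputs\<close>
  dec  :: "nat \<Rightarrow> (nat \<Rightarrow> real) \<Rightarrow> nat"                \<comment> \<open>user, output block\<close>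

lemma restrict_lessThan_fundef_cong [fundef_cong]:
  "t = t' \<Longrightarrow> (\<And>s. s < t' \<Longrightarrow> f s = f' s) \<Longrightarrow> restrict f {..<t} = restrict f' {..<t'}"
  by (auto simp: restrict_def)

context
  fixes K :: nat and snr inr :: real and C :: fb_code
    and w :: "nat \<Rightarrow> nat" and z :: "nat \<times> nat \<Rightarrow> real"
begin

text \<open>Inputs and outputs for the message tuple \<open>w\<close> and the noise realisation \<open>z\<close>,
  where \<open>z (k, t)\<close> is the noise at receiver \<open>k\<close> and time \<open>t\<close>.\<close>

function chan_in chan_out :: "nat \<Rightarrow> nat \<Rightarrow> real" where
  "chan_in k t = enc C k t (w k) (restrict (\<lambda>s. chan_out k s) {..<t})"
| "chan_out k t = sqrt snr * chan_in k t + (\<Sum>i\<in>{..<K} - {k}. sqrt inr * chan_in i t) + z (k, t)"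
  by pat_completeness auto
termination
  by (relation "Wellfounded.measure (case_sum (\<lambda>(k, t). 2 * t) (\<lambda>(k, t). 2 * t + 1))") auto

end

declare chan_in.simps [simp del] chan_out.simps [simp del]

definition out_block ::
  "nat \<Rightarrow> real \<Rightarrow> real \<Rightarrow> nat \<Rightarrow> fb_code \<Rightarrow> (nat \<Rightarrow> nat) \<Rightarrow> (nat \<times> nat \<Rightarrow> real) \<Rightarrow> nat \<Rightarrow> nat \<Rightarrow> real"
where
  "out_block K snr inr T C w z k = restrict (\<lambda>t. chan_out K snr inr C w z k t) {..<T}"

text \<open>Joint law of messages and noises: everything is independent, messages are uniform
  and noises are standard normal.\<close>

definition sample_space :: "nat \<Rightarrow> nat \<Rightarrow> fb_code \<Rightarrow> ((nat \<Rightarrow> nat) \<times> (nat \<times> nat \<Rightarrow> real)) measure"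
where
  "sample_space K T C =
     (\<Pi>\<^sub>M k\<in>{..<K}. uniform_count_measure {..<msgs C k})
     \<Otimes>\<^sub>M (\<Pi>\<^sub>M j\<in>{..<K} \<times> {..<T}. density lborel (\<lambda>u. ennreal (std_normal_density u)))"

definition fb_measurable :: "nat \<Rightarrow> nat \<Rightarrow> fb_code \<Rightarrow> bool" where
  "fb_measurable K T C \<longleftrightarrow>
     (\<forall>k<K. \<forall>t<T. \<forall>m<msgs C k. enc C k t m \<in> borel_measurable (\<Pi>\<^sub>M s\<in>{..<t}. borel)) \<and>
     (\<forall>k<K. dec C k \<in> (\<Pi>\<^sub>M s\<in>{..<T}. borel) \<rightarrow>\<^sub>M count_space UNIV)"

text \<open>Integrability is required separately because the Bochner integral of a
  non-integrable function is \<open>0\<close>.\<close>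

definition power_constraint :: "nat \<Rightarrow> real \<Rightarrow> real \<Rightarrow> nat \<Rightarrow> fb_code \<Rightarrow> bool" where
  "power_constraint K snr inr T C \<longleftrightarrow>
     (\<forall>k<K.
       (\<forall>t<T. integrable (sample_space K T C) (\<lambda>(w, z). (chan_in K snr inr C w z k t)\<^sup>2)) \<and>
       1 / real T * (\<Sum>t<T. \<integral>(w, z). (chan_in K snr inr C w z k t)\<^sup>2 \<partial>sample_space K T C) \<le> 1)"

definition fb_code_valid :: "nat \<Rightarrow> real \<Rightarrow> real \<Rightarrow> nat \<Rightarrow> fb_code \<Rightarrow> bool" where
  "fb_code_valid K snr inr T C \<longleftrightarrow>
     (\<forall>k<K. msgs C k \<ge> 1) \<and> fb_measurable K T C \<and> power_constraint K snr inr T C"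

definition error_prob :: "nat \<Rightarrow> real \<Rightarrow> real \<Rightarrow> nat \<Rightarrow> fb_code \<Rightarrow> nat \<Rightarrow> real" where
  "error_prob K snr inr T C k =
     measure (sample_space K T C)
       {(w, z) \<in> space (sample_space K T C). dec C k (out_block K snr inr T C w z k) \<noteq> w k}"

definition achievable :: "nat \<Rightarrow> real \<Rightarrow> real \<Rightarrow> (nat \<Rightarrow> real) \<Rightarrow> bool" where
  "achievable K snr inr R \<longleftrightarrow>
     (\<exists>C :: nat \<Rightarrow> fb_code.
       (\<forall>T\<ge>1. fb_code_valid K snr inr T (C T) \<and>
              (\<forall>k<K. real (msgs (C T) k) \<ge> 2 powr (real T * R k))) \<and>
       (\<forall>k<K. (\<lambda>T. error_prob K snr inr T (C T) k) \<longlonglongrightarrow> 0))"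

text \<open>The supremum is taken in \<open>ereal\<close>, where it needs no boundedness side condition.\<close>

definition R_sym :: "nat \<Rightarrow> real \<Rightarrow> real \<Rightarrow> ereal" where
  "R_sym K snr inr = Sup {ereal R | R. achievable K snr inr (\<lambda>_. R)}"

end

(*
  Converse. With equal gains the outputs at time t differ only in the noise: y_k(t) = s(t) + z_k(t),
  where s(t) depends on the messages and on earlier noise. For a fixed message tuple the map z |-> y
  is therefore triangular and preserves Lebesgue measure, and the noise density at z is at most
  a Gaussian in the K - 1 differences y_k(t) - y_0(t), times a Gaussian of variance about SNR in
  y_0(t) as long as y_0 has bounded power (Markov). The regions on which all receivers decode
  correctly are disjoint for different tuples, so the probability of correct decoding is at most
  1/2 + (const * sqrt SNR)^T / #tuples, and K * R <= (1/2) log SNR + O(1).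

  Achievability. The users take turns, each owning T div K consecutive slots. The active user sends
  its message as a point of [0,1), and then, in every slot, minus the noise of the preceding slot,
  which feedback reveals. In the sum of the a^(n-1-r) y(r), with a = sqrt SNR, all noise but the last
  cancels, leaving a^n * message + z(n-1), and Chebyshev's inequality suffices for decoding.
*)
theory Submission imports Defs begin

text \<open>Instead of entropy and Fano's inequality, the converse counts volume per channel use.
  The common signal cancels in the \<open>K - 1\<close> differences, so their widths are O(1), and a
  single direction \<open>y_0\<close> is left with a width of order sqrt SNR. The Gaussian in
  \<open>y_0\<close> is not part of the noise density: it is inserted to make the majorant
  integrable, and on the region of bounded output power it costs only exp (T / 2). With feedback,
  the outputs given the messages need not be Gaussian and the inputs may be correlated; the
  triangular change of variables asks only for causality. The 1/2 from Markov's inequality does not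
  vanish, but any constant below 1 serves: the other terms would tend to 0 at too large a rate, and
  their total must stay at least 1. In the achievable scheme the retransmitted noise has variance 1,
  so it fits the power constraint at every SNR. The message gains a factor sqrt SNR in each slot
  while the noise never accumulates, so almost SNR^(n/2) messages can be told apart after n slots
  without further coding.\<close>

section \<open>Triangular shifts of Lebesgue measure\<close>

lemma nn_integral_lborel_shift:
  fixes f :: "real \<Rightarrow> ennreal"
  assumes "f \<in> borel_measurable borel"
  shows "(\<integral>\<^sup>+ u. f (u + c) \<partial>lborel) = (\<integral>\<^sup>+ u. f u \<partial>lborel)"
  using nn_integral_real_affine[OF assms, of 1 c] by (simp add: add.commute)

text \<open>The index inserted last has maximal rank, so no \<open>h j\<close>, not even
  \<open>h x\<close>, reads the coordinate \<open>x\<close>. The integral over that coordinate is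
  then a plain translate, and induction treats the rest. Invariance needs no Jacobian, only
  measurability of the shifts.\<close>

lemma nn_integral_triangular_shift:
  fixes h :: "'i \<Rightarrow> ('i \<Rightarrow> real) \<Rightarrow> real" and r :: "'i \<Rightarrow> nat"
  assumes "finite I"
    and "\<And>j. j \<in> I \<Longrightarrow> h j \<in> borel_measurable (\<Pi>\<^sub>M i\<in>I. lborel)"
    and "\<And>j z z'. j \<in> I \<Longrightarrow> (\<And>i. i \<in> I \<Longrightarrow> r i < r j \<Longrightarrow> z i = z' i) \<Longrightarrow> h j z = h j z'"
    and "G \<in> borel_measurable (\<Pi>\<^sub>M i\<in>I. lborel)"
  shows "(\<integral>\<^sup>+ z. G (\<lambda>j\<in>I. z j + h j z) \<partial>(\<Pi>\<^sub>M i\<in>I. lborel)) = (\<integral>\<^sup>+ z. G z \<partial>(\<Pi>\<^sub>M i\<in>I. lborel))"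
  using assms
proof (induction I arbitrary: G rule: finite_ranking_induct[where f = r])
  case empty
  show ?case by (intro nn_integral_cong) (auto simp: space_PiM)
next
  case (insert x S)
  show ?case
  proof (cases "x \<in> S")
    case True
    then show ?thesis
      using insert.IH[of G] insert.prems unfolding insert_absorb[OF True] by blast
  next
    case x: False
    interpret product_sigma_finite "\<lambda>_::'i. lborel :: real measure" by standard
    note G[measurable] = insert.prems(3)
    have dep: "h j z = h j z'" if "j \<in> insert x S" "\<And>i. i \<in> S \<Longrightarrow> z i = z' i" for j z z'
    proof (rule insert.prems(2)[OF that(1)])
      fix i assume i: "i \<in> insert x S" "r i < r j"
      have "r j \<le> r x" using that(1) insert.hyps(2)[of j] by auto
      with i have "i \<in> S" by auto
      then show "z i = z' i" by (rule that(2))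
    qed
    have hS: "h j \<in> borel_measurable (\<Pi>\<^sub>M i\<in>S. lborel)" if "j \<in> insert x S" for j
    proof -
      \<comment> \<open>Since \<open>h j\<close> ignores the coordinate \<open>x\<close>, filling in
        the value 0 there transfers measurability from \<open>insert x S\<close> to
        \<open>S\<close>.\<close>
      have "(\<lambda>z. z(x := 0)) \<in> (\<Pi>\<^sub>M i\<in>S. lborel) \<rightarrow>\<^sub>M (\<Pi>\<^sub>M i\<in>insert x S. (lborel :: real measure))"
        by (rule measurable_fun_upd[where J = S]) auto
      from measurable_compose[OF this insert.prems(1)[OF that]]
      have "(\<lambda>z. h j (z(x := 0))) \<in> borel_measurable (\<Pi>\<^sub>M i\<in>S. lborel)" .
      also have "(\<lambda>z. h j (z(x := 0))) = h j"
        using x by (intro ext dep[OF that]) auto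
      finally show ?thesis .
    qed
    have upd: "(\<lambda>j\<in>insert x S. (z(x := u)) j + h j (z(x := u)))
        = (\<lambda>j\<in>S. z j + h j z)(x := u + h x z)" for z u
    proof
      fix j
      have "h j (z(x := u)) = h j z" if "j \<in> insert x S"
        using x by (intro dep[OF that]) auto
      then show "(\<lambda>j\<in>insert x S. (z(x := u)) j + h j (z(x := u))) j = ((\<lambda>j\<in>S. z j + h j z)(x := u + h x z)) j"
        using x by (cases "j = x") (simp_all add: restrict_def)
    qed
    define G' where "G' z = (\<integral>\<^sup>+ u. G (z(x := u)) \<partial>lborel)" for z
    have G'[measurable]: "G' \<in> borel_measurable (\<Pi>\<^sub>M i\<in>S. lborel)"
      unfolding G'_def by measurable
    have shift: "(\<lambda>z. \<lambda>j\<in>insert x S. z j + h j z) \<in> (\<Pi>\<^sub>M i\<in>insert x S. lborel) \<rightarrow>\<^sub>M (\<Pi>\<^sub>M i\<in>insert x S. lborel)"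
      by (intro measurable_restrict) (use insert.prems(1) in simp)
    have "(\<integral>\<^sup>+ z. G (\<lambda>j\<in>insert x S. z j + h j z) \<partial>(\<Pi>\<^sub>M i\<in>insert x S. lborel))
        = (\<integral>\<^sup>+ z. (\<integral>\<^sup>+ u. G (\<lambda>j\<in>insert x S. (z(x := u)) j + h j (z(x := u))) \<partial>lborel) \<partial>(\<Pi>\<^sub>M i\<in>S. lborel))"
      by (rule product_nn_integral_insert[OF insert.hyps(1) x measurable_compose[OF shift G]])
    also have "\<dots> = (\<integral>\<^sup>+ z. G' (\<lambda>j\<in>S. z j + h j z) \<partial>(\<Pi>\<^sub>M i\<in>S. lborel))"
    proof (intro nn_integral_cong)
      fix z assume "z \<in> space (\<Pi>\<^sub>M i\<in>S. (lborel :: real measure))"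
      have "(\<lambda>j\<in>S. z j + h j z) \<in> space (\<Pi>\<^sub>M i\<in>S. (lborel :: real measure))"
        by (auto simp: space_PiM)
      then have "(\<lambda>u. (\<lambda>j\<in>S. z j + h j z)(x := u)) \<in> borel \<rightarrow>\<^sub>M (\<Pi>\<^sub>M i\<in>insert x S. lborel)"
        by (intro measurable_fun_upd[where J = S]) auto
      from measurable_compose[OF this G]
      have "(\<lambda>u. G ((\<lambda>j\<in>S. z j + h j z)(x := u))) \<in> borel_measurable borel" .
      from nn_integral_lborel_shift[OF this, of "h x z"]
      show "(\<integral>\<^sup>+ u. G (\<lambda>j\<in>insert x S. (z(x := u)) j + h j (z(x := u))) \<partial>lborel) = G' (\<lambda>j\<in>S. z j + h j z)"
        unfolding upd G'_def .
    qed
    also have "\<dots> = (\<integral>\<^sup>+ z. G' z \<partial>(\<Pi>\<^sub>M i\<in>S. lborel))"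
    proof (rule insert.IH[OF hS _ G'])
      fix j and z z' :: "'i \<Rightarrow> real" assume j: "j \<in> S" and eq: "\<And>i. i \<in> S \<Longrightarrow> r i < r j \<Longrightarrow> z i = z' i"
      show "h j z = h j z'"
        by (rule insert.prems(2)) (use j eq insert.hyps(2) in \<open>force+\<close>)
    qed auto
    also have "\<dots> = (\<integral>\<^sup>+ z. G z \<partial>(\<Pi>\<^sub>M i\<in>insert x S. lborel))"
      unfolding G'_def by (rule product_nn_integral_insert[OF insert.hyps(1) x G, symmetric])
    finally show ?thesis .
  qed
qed

lemma PiM_density_lborel:
  fixes f :: "'i \<Rightarrow> real \<Rightarrow> ennreal"
  assumes "finite I" and [measurable]: "\<And>i. f i \<in> borel_measurable borel"
    and sf: "\<And>i. sigma_finite_measure (density lborel (f i))"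
  shows "(\<Pi>\<^sub>M i\<in>I. density lborel (f i)) = density (\<Pi>\<^sub>M i\<in>I. lborel) (\<lambda>z. \<Prod>i\<in>I. f i (z i))"
proof -
  interpret L: product_sigma_finite "\<lambda>_::'i. lborel :: real measure" by standard
  interpret D: product_sigma_finite "\<lambda>i. density lborel (f i)"
    using sf by (simp add: product_sigma_finite_def)
  show ?thesis
  proof (rule D.PiM_eqI[symmetric])
    show "sets (density (\<Pi>\<^sub>M i\<in>I. lborel) (\<lambda>z. \<Prod>i\<in>I. f i (z i))) = sets (\<Pi>\<^sub>M i\<in>I. density lborel (f i))"
      unfolding sets_density by (intro sets_PiM_cong) simp_all
    fix A assume A: "\<And>i. i \<in> I \<Longrightarrow> A i \<in> sets (density lborel (f i))"
    then have [measurable]: "Pi\<^sub>E I A \<in> sets (\<Pi>\<^sub>M i\<in>I. lborel)"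
      using \<open>finite I\<close> by (intro sets_PiM_I_finite) auto
    have "emeasure (density (\<Pi>\<^sub>M i\<in>I. lborel) (\<lambda>z. \<Prod>i\<in>I. f i (z i))) (Pi\<^sub>E I A)
        = (\<integral>\<^sup>+ z. (\<Prod>i\<in>I. f i (z i)) * indicator (Pi\<^sub>E I A) z \<partial>(\<Pi>\<^sub>M i\<in>I. lborel))"
      by (intro emeasure_density) auto
    also have "\<dots> = (\<integral>\<^sup>+ z. (\<Prod>i\<in>I. f i (z i) * indicator (A i) (z i)) \<partial>(\<Pi>\<^sub>M i\<in>I. lborel))"
    proof (intro nn_integral_cong)
      fix z assume z: "z \<in> space (\<Pi>\<^sub>M i\<in>I. (lborel :: real measure))"
      show "(\<Prod>i\<in>I. f i (z i)) * indicator (Pi\<^sub>E I A) z = (\<Prod>i\<in>I. f i (z i) * indicator (A i) (z i))"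
      proof (cases "z \<in> Pi\<^sub>E I A")
        case True
        then show ?thesis by (auto intro!: prod.cong simp: PiE_mem[OF True])
      next
        case False
        with z obtain i where "i \<in> I" "z i \<notin> A i" by (auto simp: space_PiM PiE_def)
        then have "(\<Prod>i\<in>I. f i (z i) * indicator (A i) (z i)) = 0"
          using \<open>finite I\<close> by (intro prod_zero) (auto intro!: bexI[of _ i])
        with False show ?thesis by simp
      qed
    qed
    also have "\<dots> = (\<Prod>i\<in>I. \<integral>\<^sup>+ u. f i u * indicator (A i) u \<partial>lborel)"
      using A \<open>finite I\<close> by (intro L.product_nn_integral_prod) auto
    also have "\<dots> = (\<Prod>i\<in>I. emeasure (density lborel (f i)) (A i))"
      using A by (intro prod.cong) (auto simp: emeasure_density)
    finally show "emeasure (density (\<Pi>\<^sub>M i\<in>I. lborel) (\<lambda>z. \<Prod>i\<in>I. f i (z i))) (Pi\<^sub>E I A)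
        = (\<Prod>i\<in>I. emeasure (density lborel (f i)) (A i))" .
  qed fact
qed

section \<open>The sample space and the channel\<close>

definition msg_tuples :: "nat \<Rightarrow> fb_code \<Rightarrow> (nat \<Rightarrow> nat) set" where
  "msg_tuples K C = (\<Pi>\<^sub>E k\<in>{..<K}. {..<msgs C k})"

definition noise_space :: "nat \<Rightarrow> nat \<Rightarrow> (nat \<times> nat \<Rightarrow> real) measure" where
  "noise_space K T = (\<Pi>\<^sub>M j\<in>{..<K} \<times> {..<T}. density lborel (\<lambda>u. ennreal (std_normal_density u)))"

lemma finite_msg_tuples: "finite (msg_tuples K C)"
  unfolding msg_tuples_def by (intro finite_PiE) auto

lemma card_msg_tuples: "card (msg_tuples K C) = (\<Prod>k<K. msgs C k)"
  unfolding msg_tuples_def by (simp add: card_PiE)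

text \<open>This makes the law of the messages one uniform law on a finite set, so that expectations
  become averages over message tuples. Finiteness is asked of every \<open>B i\<close> because
  \<open>product_sigma_finite\<close> speaks of all indices.\<close>

lemma PiM_uniform_count_measure:
  assumes "finite I" and "\<And>i. finite (B i)" and "\<And>i. i \<in> I \<Longrightarrow> B i \<noteq> {}"
  shows "(\<Pi>\<^sub>M i\<in>I. uniform_count_measure (B i)) = uniform_count_measure (Pi\<^sub>E I B)"
proof (rule measure_eqI_countable')
  have sets: "sets (\<Pi>\<^sub>M i\<in>I. uniform_count_measure (B i)) = sets (count_space (Pi\<^sub>E I B))"
    unfolding count_space_PiM_finite[OF assms(1) countable_finite[OF assms(2)], symmetric]
    by (intro sets_PiM_cong refl sets_uniform_count_measure_count_space)
  show "space (\<Pi>\<^sub>M i\<in>I. uniform_count_measure (B i)) = Pi\<^sub>E I B"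
    by (simp add: space_PiM space_uniform_count_measure)
  show "space (uniform_count_measure (Pi\<^sub>E I B)) = Pi\<^sub>E I B"
    by (simp add: space_uniform_count_measure)
  show "countable (Pi\<^sub>E I B)"
    using assms by (intro countable_finite finite_PiE)
  fix f assume f: "f \<in> Pi\<^sub>E I B"
  then show "{f} \<in> sets (\<Pi>\<^sub>M i\<in>I. uniform_count_measure (B i))"
    by (simp add: sets)
  show "{f} \<in> sets (uniform_count_measure (Pi\<^sub>E I B))"
    using f by (simp add: sets_uniform_count_measure)
  interpret product_sigma_finite "\<lambda>i. uniform_count_measure (B i)"
  proof (rule product_sigma_finite.intro)
    fix i
    have "finite_measure (uniform_count_measure (B i))"
      using assms(2)[of i]
      by (intro finite_measureI) (simp add: emeasure_uniform_count_measure space_uniform_count_measure)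
    then show "sigma_finite_measure (uniform_count_measure (B i))"
      by (rule finite_measure.axioms(1))
  qed
  have "{f} = Pi\<^sub>E I (\<lambda>x. {f x})"
    using f by (intro PiE_singleton[symmetric]) (auto simp: PiE_def)
  then have "emeasure (\<Pi>\<^sub>M i\<in>I. uniform_count_measure (B i)) {f}
      = (\<Prod>i\<in>I. emeasure (uniform_count_measure (B i)) {f i})"
    using f assms(1) by (simp add: emeasure_PiM sets_uniform_count_measure PiE_iff)
  also have "\<dots> = (\<Prod>i\<in>I. ennreal (1 / card (B i)))"
    using f assms(2) by (intro prod.cong refl) (simp add: emeasure_uniform_count_measure PiE_mem)
  also have "\<dots> = ennreal (1 / card (Pi\<^sub>E I B))"
    using assms(1) by (simp add: prod_ennreal card_PiE prod_dividef)
  also have "\<dots> = emeasure (uniform_count_measure (Pi\<^sub>E I B)) {f}"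
    using f assms by (simp add: emeasure_uniform_count_measure finite_PiE)
  finally show "emeasure (\<Pi>\<^sub>M i\<in>I. uniform_count_measure (B i)) {f}
      = emeasure (uniform_count_measure (Pi\<^sub>E I B)) {f}" .
qed

lemma sample_space_eq:
  assumes "\<forall>k<K. msgs C k \<ge> 1"
  shows "sample_space K T C = uniform_count_measure (msg_tuples K C) \<Otimes>\<^sub>M noise_space K T"
proof -
  have "(\<Pi>\<^sub>M k\<in>{..<K}. uniform_count_measure {..<msgs C k}) = uniform_count_measure (msg_tuples K C)"
    unfolding msg_tuples_def using assms by (intro PiM_uniform_count_measure) (auto simp: Suc_le_eq lessThan_empty_iff)
  then show ?thesis
    by (simp add: sample_space_def noise_space_def)
qed

lemma sets_noise_space [measurable_cong]:
  "sets (noise_space K T) = sets (\<Pi>\<^sub>M j\<in>{..<K} \<times> {..<T}. (lborel :: real measure))"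
  unfolding noise_space_def by (intro sets_PiM_cong) simp_all

lemma prob_space_std_normal: "prob_space (density lborel (\<lambda>u. ennreal (std_normal_density u)))"
  using prob_space_normal_density[of 1 0] by simp

lemma prob_space_noise_space: "prob_space (noise_space K T)"
  unfolding noise_space_def by (intro prob_space_PiM prob_space_std_normal)

lemma prob_space_sample_space:
  assumes "\<forall>k<K. msgs C k \<ge> 1"
  shows "prob_space (sample_space K T C)"
proof -
  have "prob_space (uniform_count_measure {..<msgs C k})" if "k < K" for k
    using assms that by (intro prob_space_uniform_count_measure) (auto simp: Suc_le_eq lessThan_empty_iff)
  then have "prob_space (\<Pi>\<^sub>M k\<in>{..<K}. uniform_count_measure {..<msgs C k})"
    by (intro prob_space_PiM) auto
  then show ?thesis
    unfolding sample_space_def using prob_space_noise_space[of K T, unfolded noise_space_def]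
    by (rule prob_space_pair)
qed

text \<open>There are only finitely many message tuples, so measurability can be checked for each
  fixed tuple.\<close>

lemma measurable_sample_space:
  assumes "\<forall>k<K. msgs C k \<ge> 1"
    and "\<And>w. w \<in> msg_tuples K C \<Longrightarrow> (\<lambda>z. f (w, z)) \<in> noise_space K T \<rightarrow>\<^sub>M L"
  shows "f \<in> sample_space K T C \<rightarrow>\<^sub>M L"
proof -
  have "sets (sample_space K T C) = sets (count_space (msg_tuples K C) \<Otimes>\<^sub>M noise_space K T)"
    unfolding sample_space_eq[OF assms(1)] by (intro sets_pair_measure_cong sets_uniform_count_measure_count_space refl)
  moreover have "f \<in> count_space (msg_tuples K C) \<Otimes>\<^sub>M noise_space K T \<rightarrow>\<^sub>M L"
    using assms(2) by (intro measurable_pair_measure_countable1 countable_finite finite_msg_tuples)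
  ultimately show ?thesis
    by (simp cong: measurable_cong_sets)
qed

lemma nn_integral_sample_space:
  assumes "\<forall>k<K. msgs C k \<ge> 1" and f: "f \<in> borel_measurable (sample_space K T C)"
  shows "(\<integral>\<^sup>+ x. f x \<partial>sample_space K T C)
    = ennreal (1 / (\<Prod>k<K. real (msgs C k))) * (\<Sum>w\<in>msg_tuples K C. \<integral>\<^sup>+ z. f (w, z) \<partial>noise_space K T)"
proof -
  interpret prob_space "noise_space K T" by (rule prob_space_noise_space)
  have "(\<integral>\<^sup>+ x. f x \<partial>sample_space K T C)
      = (\<integral>\<^sup>+ w. (\<integral>\<^sup>+ z. f (w, z) \<partial>noise_space K T) \<partial>uniform_count_measure (msg_tuples K C))"
    using f unfolding sample_space_eq[OF assms(1)] by (intro nn_integral_fst[symmetric])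
  also have "\<dots> = (\<Sum>w\<in>msg_tuples K C. ennreal (1 / (\<Prod>k<K. real (msgs C k))) * (\<integral>\<^sup>+ z. f (w, z) \<partial>noise_space K T))"
    unfolding uniform_count_measure_def
    by (subst nn_integral_point_measure_finite) (simp_all add: finite_msg_tuples card_msg_tuples of_nat_prod)
  finally show ?thesis
    by (simp add: sum_distrib_left)
qed

lemma nn_integral_sample_space_noise:
  assumes msgs: "\<forall>k<K. msgs C k \<ge> 1" and j: "j \<in> {..<K} \<times> {..<T}" and f[measurable]: "f \<in> borel_measurable borel"
  shows "(\<integral>\<^sup>+ (w, z). f (z j) \<partial>sample_space K T C) = (\<integral>\<^sup>+ u. ennreal (std_normal_density u) * f u \<partial>lborel)"
proof -
  let ?D = "density lborel (\<lambda>u. ennreal (std_normal_density u))"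
  have zj[measurable]: "(\<lambda>z. z j) \<in> borel_measurable (noise_space K T)"
    using j by measurable
  have "(\<integral>\<^sup>+ z. f (z j) \<partial>noise_space K T) = (\<integral>\<^sup>+ u. f u \<partial>distr (noise_space K T) ?D (\<lambda>z. z j))"
    by (subst nn_integral_distr) simp_all
  also have "distr (noise_space K T) ?D (\<lambda>z. z j) = ?D"
    unfolding noise_space_def using j by (intro distr_PiM_component prob_space_std_normal)
  also have "(\<integral>\<^sup>+ u. f u \<partial>?D) = (\<integral>\<^sup>+ u. ennreal (std_normal_density u) * f u \<partial>lborel)"
    by (subst nn_integral_density) simp_all
  finally have z: "(\<integral>\<^sup>+ z. f (z j) \<partial>noise_space K T) = (\<integral>\<^sup>+ u. ennreal (std_normal_density u) * f u \<partial>lborel)" .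
  have "(\<lambda>(w, z). f (z j)) \<in> borel_measurable (sample_space K T C)"
    using msgs by (rule measurable_sample_space) simp
  then have "(\<integral>\<^sup>+ (w, z). f (z j) \<partial>sample_space K T C)
      = ennreal (1 / (\<Prod>k<K. real (msgs C k))) * (\<Sum>w\<in>msg_tuples K C. \<integral>\<^sup>+ z. f (z j) \<partial>noise_space K T)"
    using msgs by (simp add: nn_integral_sample_space)
  also have "\<dots> = ennreal (1 / (\<Prod>k<K. real (msgs C k))) * ennreal (\<Prod>k<K. real (msgs C k)) * (\<integral>\<^sup>+ z. f (z j) \<partial>noise_space K T)"
    by (simp add: card_msg_tuples mult.assoc of_nat_prod flip: ennreal_of_nat_eq_real_of_nat prod_ennreal)
  also have "ennreal (1 / (\<Prod>k<K. real (msgs C k))) * ennreal (\<Prod>k<K. real (msgs C k)) = 1"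
    using msgs by (subst ennreal_mult[symmetric]) (auto intro!: prod_nonneg simp: Suc_le_eq)
  finally show ?thesis
    using z by simp
qed

lemma nn_integral_noise_power:
  assumes "\<forall>k<K. msgs C k \<ge> 1" and "j \<in> {..<K} \<times> {..<T}"
  shows "(\<integral>\<^sup>+ (w, z). ennreal ((z j)\<^sup>2) \<partial>sample_space K T C) = 1"
proof -
  have "(\<integral>\<^sup>+ (w, z). ennreal ((z j)\<^sup>2) \<partial>sample_space K T C)
      = (\<integral>\<^sup>+ u. ennreal (std_normal_density u) * ennreal (u\<^sup>2) \<partial>lborel)"
    using assms by (rule nn_integral_sample_space_noise) simp
  also have "\<dots> = (\<integral>\<^sup>+ u. ennreal (std_normal_density u * u ^ (2 * 1)) \<partial>lborel)"
    by (intro nn_integral_cong) (simp add: ennreal_mult)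
  \<comment> \<open>The even moment formula at exponent 2 gives 2! / (2 * 1!) = 1.\<close>
  also have "\<dots> = 1"
    using std_normal_moment_even[of 1]
    by (subst nn_integral_eq_integral) (auto simp: has_bochner_integral_iff fact_numeral)
  finally show ?thesis .
qed

text \<open>Inputs and outputs share one induction on time, as the input at \<open>t\<close> reads
  the outputs before \<open>t\<close>. The domain is the product of Lebesgue measures because the
  change of variables takes place there; \<open>sets_noise_space\<close> carries the result over to
  the noise.\<close>

lemma chan_measurable:
  assumes fb: "fb_measurable K T C" and w: "w \<in> msg_tuples K C" and t: "t < T"
  shows "\<forall>k<K. (\<lambda>z. chan_in K snr inr C w z k t) \<in> borel_measurable (\<Pi>\<^sub>M j\<in>{..<K} \<times> {..<T}. lborel)
    \<and> (\<lambda>z. chan_out K snr inr C w z k t) \<in> borel_measurable (\<Pi>\<^sub>M j\<in>{..<K} \<times> {..<T}. lborel)"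
  using t
proof (induction t rule: less_induct)
  case (less t)
  let ?M = "\<Pi>\<^sub>M j\<in>{..<K} \<times> {..<T}. (lborel :: real measure)"
  have x: "(\<lambda>z. chan_in K snr inr C w z k t) \<in> borel_measurable ?M" if k: "k < K" for k
  proof -
    have "w k < msgs C k"
      using w k by (auto simp: msg_tuples_def)
    then have enc: "enc C k t (w k) \<in> borel_measurable (\<Pi>\<^sub>M s\<in>{..<t}. borel)"
      using fb k less.prems by (auto simp: fb_measurable_def)
    have "(\<lambda>z. restrict (\<lambda>s. chan_out K snr inr C w z k s) {..<t}) \<in> ?M \<rightarrow>\<^sub>M (\<Pi>\<^sub>M s\<in>{..<t}. borel)"
      using less k by (intro measurable_restrict) auto
    from measurable_compose[OF this enc] show ?thesis
      by (simp add: chan_in.simps[abs_def])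
  qed
  have "(\<lambda>z. chan_out K snr inr C w z k t) \<in> borel_measurable ?M" if k: "k < K" for k
  proof -
    have "(\<lambda>z. z (k, t)) \<in> borel_measurable ?M"
      using k less.prems measurable_component_singleton[of "(k, t)" "{..<K} \<times> {..<T}" "\<lambda>_. lborel :: real measure"] by simp
    then show ?thesis
      unfolding chan_out.simps by (intro borel_measurable_add borel_measurable_times borel_measurable_sum borel_measurable_const x k) auto
  qed
  with x show ?case by blast
qed

text \<open>Causality: only noise strictly before \<open>t\<close> reaches the input at
  \<open>t\<close>. This is the dependence that \<open>nn_integral_triangular_shift\<close> asks
  for, with time as the rank.\<close>

lemma chan_in_cong:
  assumes "\<And>i s. i < K \<Longrightarrow> s < t \<Longrightarrow> z (i, s) = z' (i, s)" and "k < K"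
  shows "chan_in K snr inr C w z k t = chan_in K snr inr C w z' k t"
  using assms
proof (induction t arbitrary: k rule: less_induct)
  case (less t)
  have "chan_out K snr inr C w z k s = chan_out K snr inr C w z' k s" if s: "s < t" for s
  proof -
    have "chan_in K snr inr C w z i s = chan_in K snr inr C w z' i s" if "i < K" for i
      by (rule less.IH[OF s _ that]) (use less.prems(1) s in auto)
    then show ?thesis
      unfolding chan_out.simps using less.prems s by (auto intro!: sum.cong)
  qed
  then show ?case
    by (simp add: chan_in.simps cong: restrict_cong)
qed

section \<open>Converse\<close>

lemma chan_out_equal_gains:
  assumes "k < K"
  shows "chan_out K snr snr C w z k t = z (k, t) + sqrt snr * (\<Sum>i<K. chan_in K snr snr C w z i t)"
  using assms
  by (simp add: chan_out.simps sum.remove[of "{..<K}" k] sum_distrib_left algebra_simps)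

text \<open>\<open>out_weight\<close> is an integrable majorant, as a function of the outputs, of the noise density. The
  constant \<open>2 K + 2\<close> comes from \<open>\<Sum>k. (z k - z 0)\<^sup>2 \<le> (2 K + 2) (\<Sum>k. (z k)\<^sup>2)\<close>.\<close>

definition out_scale :: "nat \<Rightarrow> real \<Rightarrow> nat \<Rightarrow> real" where
  "out_scale K S k = (if k = 0 then sqrt S else sqrt (2 * real K + 2))"

definition out_weight :: "nat \<Rightarrow> nat \<Rightarrow> real \<Rightarrow> (nat \<times> nat \<Rightarrow> real) \<Rightarrow> real" where
  "out_weight K T S y = exp (real T / 2) * (\<Prod>(k, t)\<in>{..<K} \<times> {..<T}.
     out_scale K S k * normal_density 0 (out_scale K S k) (y (k, t) + (if k = 0 then 0 else - y (0, t))))"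

lemma out_scale_pos: "0 < S \<Longrightarrow> 0 < out_scale K S k"
  by (simp add: out_scale_def)

text \<open>Both sides carry the same constant per coordinate, so only exponents are compared. The
  signal \<open>a t\<close> cancels in the differences to user 0, whose squares are paid for by the
  noise energy. The terms in \<open>y (0, t)\<close> add at most T / 2 by \<open>le\<close>, and the
  factor \<open>exp (real T / 2)\<close> of \<open>out_weight\<close> returns this.\<close>

lemma gaussian_noise_density_le:
  fixes z y :: "nat \<times> nat \<Rightarrow> real" and a :: "nat \<Rightarrow> real"
  assumes K: "0 < K" and S: "0 < S"
    and y: "\<And>k t. k < K \<Longrightarrow> t < T \<Longrightarrow> y (k, t) = z (k, t) + a t"
    and le: "(\<Sum>t<T. (y (0, t))\<^sup>2) \<le> S * real T"
  shows "(\<Prod>j\<in>{..<K} \<times> {..<T}. std_normal_density (z j)) \<le> out_weight K T S y"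
proof -
  let ?I = "{..<K} \<times> {..<T}"
  define v where "v k t = y (k, t) + (if k = 0 then 0 else - y (0, t))" for k t
  define c where "c = 1 / sqrt (2 * pi)"
  define \<sigma> where "\<sigma> = out_scale K S"
  have \<sigma>: "\<sigma> k > 0" for k
    using S by (simp add: \<sigma>_def out_scale_pos)
  have \<sigma>2: "(\<sigma> k)\<^sup>2 = (if k = 0 then S else 2 * real K + 2)" for k
    using S by (simp add: \<sigma>_def out_scale_def)
  have c: "c > 0" by (simp add: c_def)
  \<comment> \<open>The factor \<open>\<sigma> k\<close> removes the width from the normalisation
    and leaves the constant of the standard normal density.\<close>
  have nd: "\<sigma> k * normal_density 0 (\<sigma> k) u = exp (- (u\<^sup>2 / (2 * (\<sigma> k)\<^sup>2))) * c" for k u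
    using \<sigma>[of k] by (simp add: normal_density_def c_def real_sqrt_mult)
  have sd: "std_normal_density u = exp (- (u\<^sup>2 / 2)) * c" for u
    by (simp add: std_normal_density_def c_def)
  have lhs: "(\<Prod>j\<in>?I. std_normal_density (z j)) = exp (- (\<Sum>j\<in>?I. (z j)\<^sup>2 / 2)) * c ^ card ?I"
    by (simp add: sd prod.distrib exp_sum flip: sum_negf)
  have rhs: "(\<Prod>(k, t)\<in>?I. \<sigma> k * normal_density 0 (\<sigma> k) (v k t))
      = exp (- (\<Sum>(k, t)\<in>?I. (v k t)\<^sup>2 / (2 * (\<sigma> k)\<^sup>2))) * c ^ card ?I"
    by (simp add: nd case_prod_beta prod.distrib exp_sum flip: sum_negf)
  have swap: "(\<Sum>j\<in>?I. f j) = (\<Sum>t<T. \<Sum>k<K. f (k, t))" for f :: "nat \<times> nat \<Rightarrow> real"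
    by (subst sum.swap) (simp add: sum.cartesian_product)
  have slot: "(\<Sum>k<K. (v k t)\<^sup>2 / (2 * (\<sigma> k)\<^sup>2)) \<le> (y (0, t))\<^sup>2 / (2 * S) + (\<Sum>k<K. (z (k, t))\<^sup>2 / 2)"
    if t: "t < T" for t
  proof -
    let ?d = "2 * (2 * real K + 2)"
    \<comment> \<open>For \<open>k = 0\<close> the noise fraction is slack. Keeping it gives every
      user the same fraction, hence \<open>K\<close> copies of the square of \<open>z (0, t)\<close>
      in the sum.\<close>
    have "(v k t)\<^sup>2 / (2 * (\<sigma> k)\<^sup>2) \<le> (if k = 0 then (y (0, t))\<^sup>2 / (2 * S) else 0)
        + (2 * (z (k, t))\<^sup>2 + 2 * (z (0, t))\<^sup>2) / ?d" if k: "k < K" for k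
    proof (cases "k = 0")
      case True
      then show ?thesis by (simp add: v_def \<sigma>2)
    next
      case False
      then have "v k t = z (k, t) - z (0, t)"
        using y[OF k t] y[OF K t] by (simp add: v_def)
      moreover have "(z (k, t) - z (0, t))\<^sup>2 \<le> 2 * (z (k, t))\<^sup>2 + 2 * (z (0, t))\<^sup>2"
        using zero_le_power2[of "z (k, t) + z (0, t)"] by (simp add: power2_sum power2_diff)
      ultimately show ?thesis
        using False by (simp add: \<sigma>2 divide_right_mono)
    qed
    then have "(\<Sum>k<K. (v k t)\<^sup>2 / (2 * (\<sigma> k)\<^sup>2)) \<le> (\<Sum>k<K. (if k = 0 then (y (0, t))\<^sup>2 / (2 * S) else 0)
        + (2 * (z (k, t))\<^sup>2 + 2 * (z (0, t))\<^sup>2) / ?d)"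
      by (intro sum_mono) simp
    also have "\<dots> = (y (0, t))\<^sup>2 / (2 * S) + (2 * (\<Sum>k<K. (z (k, t))\<^sup>2) + 2 * real K * (z (0, t))\<^sup>2) / ?d"
      using K by (simp add: sum.distrib sum_divide_distrib[symmetric] sum_distrib_left[symmetric])
    also have "(2 * (\<Sum>k<K. (z (k, t))\<^sup>2) + 2 * real K * (z (0, t))\<^sup>2) / ?d
        \<le> (2 * (\<Sum>k<K. (z (k, t))\<^sup>2) + 2 * real K * (\<Sum>k<K. (z (k, t))\<^sup>2)) / ?d"
      using K member_le_sum[of 0 "{..<K}" "\<lambda>k. (z (k, t))\<^sup>2"]
      by (intro divide_right_mono add_left_mono mult_left_mono) auto
    also have "\<dots> = (\<Sum>k<K. (z (k, t))\<^sup>2 / 2)"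
      by (simp add: sum_divide_distrib[symmetric] field_simps)
    finally show ?thesis by simp
  qed
  have "(\<Sum>(k, t)\<in>?I. (v k t)\<^sup>2 / (2 * (\<sigma> k)\<^sup>2)) = (\<Sum>t<T. \<Sum>k<K. (v k t)\<^sup>2 / (2 * (\<sigma> k)\<^sup>2))"
    by (simp add: swap)
  also have "\<dots> \<le> (\<Sum>t<T. (y (0, t))\<^sup>2 / (2 * S) + (\<Sum>k<K. (z (k, t))\<^sup>2 / 2))"
    using slot by (intro sum_mono) simp
  also have "\<dots> = (\<Sum>t<T. (y (0, t))\<^sup>2) / (2 * S) + (\<Sum>j\<in>?I. (z j)\<^sup>2 / 2)"
    by (simp add: swap sum.distrib sum_divide_distrib)
  also have "(\<Sum>t<T. (y (0, t))\<^sup>2) / (2 * S) \<le> real T / 2"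
    using le S by (simp add: field_simps)
  finally have "- (\<Sum>j\<in>?I. (z j)\<^sup>2 / 2) \<le> real T / 2 - (\<Sum>(k, t)\<in>?I. (v k t)\<^sup>2 / (2 * (\<sigma> k)\<^sup>2))"
    by simp
  then have "exp (- (\<Sum>j\<in>?I. (z j)\<^sup>2 / 2)) \<le> exp (real T / 2) * exp (- (\<Sum>(k, t)\<in>?I. (v k t)\<^sup>2 / (2 * (\<sigma> k)\<^sup>2)))"
    by (simp flip: exp_add)
  then have "exp (- (\<Sum>j\<in>?I. (z j)\<^sup>2 / 2)) * c ^ card ?I
      \<le> exp (real T / 2) * exp (- (\<Sum>(k, t)\<in>?I. (v k t)\<^sup>2 / (2 * (\<sigma> k)\<^sup>2))) * c ^ card ?I"
    using c by (intro mult_right_mono) auto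
  then show ?thesis
    unfolding lhs out_weight_def \<sigma>_def[symmetric] v_def[symmetric] rhs by (simp add: mult.assoc)
qed

text \<open>Subtracting the coordinate of user 0 is a triangular shift with the user index as rank.
  Undoing it separates the variables, and each one-dimensional density of mass 1 leaves its factor
  \<open>\<sigma> k\<close>.\<close>

lemma nn_integral_differenced_gaussians:
  fixes \<sigma> :: "nat \<Rightarrow> real" and c :: ennreal and K T :: nat
  assumes \<sigma>: "\<And>k. \<sigma> k > 0"
  defines "I \<equiv> {..<K} \<times> {..<T}"
  shows "(\<integral>\<^sup>+ y. c * ennreal (\<Prod>(k, t)\<in>I. \<sigma> k * normal_density 0 (\<sigma> k) (y (k, t) + (if k = 0 then 0 else - y (0, t))))
      \<partial>(\<Pi>\<^sub>M j\<in>I. lborel)) = c * ennreal ((\<Prod>k<K. \<sigma> k) ^ T)"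
proof -
  interpret product_sigma_finite "\<lambda>_::nat \<times> nat. lborel :: real measure" by standard
  define h :: "nat \<times> nat \<Rightarrow> (nat \<times> nat \<Rightarrow> real) \<Rightarrow> real"
    where "h j y = (if fst j = 0 then 0 else - y (0, snd j))" for j y
  define G where "G y = c * (\<Prod>j\<in>I. ennreal (\<sigma> (fst j) * normal_density 0 (\<sigma> (fst j)) (y j)))" for y
  have fin: "finite I" by (simp add: I_def)
  have h: "h j \<in> borel_measurable (\<Pi>\<^sub>M j\<in>I. lborel)" if j: "j \<in> I" for j
  proof (cases "fst j = 0")
    case False
    then have "(0, snd j) \<in> I" using j by (auto simp: I_def)
    then have "(\<lambda>y. y (0, snd j)) \<in> borel_measurable (\<Pi>\<^sub>M j\<in>I. (lborel :: real measure))"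
      using measurable_component_singleton[of _ I "\<lambda>_. lborel :: real measure"] by simp
    with False show ?thesis by (simp add: h_def[abs_def])
  qed (simp add: h_def[abs_def])
  have dep: "h j y = h j y'"
    if "j \<in> I" "\<And>i. i \<in> I \<Longrightarrow> fst i < fst j \<Longrightarrow> y i = y' i" for j y y'
    using that(1) that(2)[of "(0, snd j)"] by (auto simp: h_def I_def)
  have comp: "(\<lambda>y. y j) \<in> borel_measurable (\<Pi>\<^sub>M j\<in>I. (lborel :: real measure))" if "j \<in> I" for j
    using measurable_component_singleton[of j I "\<lambda>_. lborel :: real measure"] that by simp
  have G: "G \<in> borel_measurable (\<Pi>\<^sub>M j\<in>I. lborel)"
    unfolding G_def
    by (intro borel_measurable_times_ennreal borel_measurable_prod_ennreal borel_measurable_const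
        measurable_compose[OF comp, of _ "\<lambda>u. ennreal (\<sigma> _ * normal_density 0 (\<sigma> _) u)"]) auto
  have "(\<integral>\<^sup>+ y. c * ennreal (\<Prod>(k, t)\<in>I. \<sigma> k * normal_density 0 (\<sigma> k) (y (k, t) + (if k = 0 then 0 else - y (0, t))))
      \<partial>(\<Pi>\<^sub>M j\<in>I. lborel)) = (\<integral>\<^sup>+ y. G (\<lambda>j\<in>I. y j + h j y) \<partial>(\<Pi>\<^sub>M j\<in>I. lborel))"
    using \<sigma> by (intro nn_integral_cong)
      (simp add: G_def h_def case_prod_beta prod_ennreal less_imp_le)
  also have "\<dots> = (\<integral>\<^sup>+ y. G y \<partial>(\<Pi>\<^sub>M j\<in>I. lborel))"
    by (rule nn_integral_triangular_shift[where r = fst, OF fin h dep G])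
  also have "\<dots> = c * (\<integral>\<^sup>+ y. (\<Prod>j\<in>I. ennreal (\<sigma> (fst j) * normal_density 0 (\<sigma> (fst j)) (y j))) \<partial>(\<Pi>\<^sub>M j\<in>I. lborel))"
    unfolding G_def
    by (intro nn_integral_cmult borel_measurable_prod_ennreal
        measurable_compose[OF comp, of _ "\<lambda>u. ennreal (\<sigma> _ * normal_density 0 (\<sigma> _) u)"]) auto
  also have "\<dots> = c * (\<Prod>j\<in>I. \<integral>\<^sup>+ u. ennreal (\<sigma> (fst j) * normal_density 0 (\<sigma> (fst j)) u) \<partial>lborel)"
    using fin by (subst product_nn_integral_prod) auto
  also have "\<dots> = c * (\<Prod>j\<in>I. ennreal (\<sigma> (fst j)))"
  proof (intro arg_cong[where f = "times c"] prod.cong refl)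
    fix j
    have "(\<integral>\<^sup>+ u. ennreal (\<sigma> (fst j) * normal_density 0 (\<sigma> (fst j)) u) \<partial>lborel)
        = ennreal (\<integral> u. \<sigma> (fst j) * normal_density 0 (\<sigma> (fst j)) u \<partial>lborel)"
      using \<sigma>[of "fst j"] by (intro nn_integral_eq_integral) auto
    then show "(\<integral>\<^sup>+ u. ennreal (\<sigma> (fst j) * normal_density 0 (\<sigma> (fst j)) u) \<partial>lborel) = ennreal (\<sigma> (fst j))"
      using \<sigma>[of "fst j"] by simp
  qed
  also have "\<dots> = c * ennreal ((\<Prod>k<K. \<sigma> k) ^ T)"
    using \<sigma> prod.cartesian_product[of "\<lambda>k t. \<sigma> k" "{..<T}" "{..<K}", symmetric]
    by (simp add: prod_ennreal less_imp_le I_def case_prod_beta prod_power_distrib)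
  finally show ?thesis .
qed

lemma measurable_PiM_lborel_component:
  "j \<in> I \<Longrightarrow> (\<lambda>y. y j) \<in> borel_measurable (\<Pi>\<^sub>M j\<in>I. (lborel :: real measure))"
  using measurable_component_singleton[of j I "\<lambda>_. lborel :: real measure"] by simp

lemma borel_measurable_out_weight:
  assumes "0 < K"
  shows "out_weight K T S \<in> borel_measurable (\<Pi>\<^sub>M j\<in>{..<K} \<times> {..<T}. lborel)"
proof -
  let ?I = "{..<K} \<times> {..<T}"
  have "(\<lambda>y. normal_density 0 (out_scale K S (fst j)) (y (fst j, snd j) + (if fst j = 0 then 0 else - y (0, snd j))))
      \<in> borel_measurable (\<Pi>\<^sub>M j\<in>?I. lborel)" if "j \<in> ?I" for j
  proof -
    have "(\<lambda>y. y (fst j, snd j) + (if fst j = 0 then 0 else - y (0, snd j))) \<in> borel_measurable (\<Pi>\<^sub>M j\<in>?I. (lborel :: real measure))"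
      using that assms measurable_PiM_lborel_component[of j ?I] measurable_PiM_lborel_component[of "(0, snd j)" ?I]
      by (cases "fst j = 0") auto
    from measurable_compose[OF this, of "normal_density 0 (out_scale K S (fst j))" borel]
    show ?thesis by simp
  qed
  then show ?thesis
    unfolding out_weight_def[abs_def] case_prod_beta
    by (intro borel_measurable_times borel_measurable_const borel_measurable_prod)
qed

text \<open>In each channel use only the coordinate of user 0 has a width depending on
  \<open>S\<close>. This one factor \<open>sqrt S\<close> is the source of the half logarithm shared
  by all users; \<open>exp (real T / 2)\<close> becomes a factor sqrt e per channel use.\<close>

lemma nn_integral_out_weight:
  assumes "0 < K" "0 < S"
  shows "(\<integral>\<^sup>+ y. ennreal (out_weight K T S y) \<partial>(\<Pi>\<^sub>M j\<in>{..<K} \<times> {..<T}. lborel))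
    = ennreal ((sqrt (exp 1 * S) * sqrt (2 * real K + 2) ^ (K - 1)) ^ T)"
proof -
  have "(\<Prod>k<K. out_scale K S k) = out_scale K S 0 * (\<Prod>k\<in>{..<K} - {0}. out_scale K S k)"
    using assms by (intro prod.remove) auto
  also have "(\<Prod>k\<in>{..<K} - {0}. out_scale K S k) = (\<Prod>k\<in>{..<K} - {0}. sqrt (2 * real K + 2))"
    by (intro prod.cong) (auto simp: out_scale_def)
  also have "\<dots> = sqrt (2 * real K + 2) ^ (K - 1)"
    using assms by simp
  finally have prod: "(\<Prod>k<K. out_scale K S k) = sqrt S * sqrt (2 * real K + 2) ^ (K - 1)"
    by (simp add: out_scale_def)
  have "sqrt (exp 1) = exp (1 / 2)"
    by (rule real_sqrt_unique) (simp_all add: power2_eq_square flip: exp_add)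
  then have e: "exp (real T / 2) = sqrt (exp 1) ^ T"
    by (simp flip: exp_of_nat_mult)
  have "(\<integral>\<^sup>+ y. ennreal (out_weight K T S y) \<partial>(\<Pi>\<^sub>M j\<in>{..<K} \<times> {..<T}. lborel))
      = ennreal (exp (real T / 2)) * ennreal ((\<Prod>k<K. out_scale K S k) ^ T)"
    unfolding nn_integral_differenced_gaussians[of "out_scale K S", OF out_scale_pos[OF assms(2)], symmetric] out_weight_def
    by (simp add: ennreal_mult')
  also have "\<dots> = ennreal ((sqrt (exp 1 * S) * sqrt (2 * real K + 2) ^ (K - 1)) ^ T)"
    unfolding prod e real_sqrt_mult by (simp add: ennreal_mult'[symmetric] power_mult_distrib mult.assoc)
  finally show ?thesis .
qed

section \<open>Change of variables from the noise to the outputs\<close>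

definition chan_outs :: "nat \<Rightarrow> real \<Rightarrow> nat \<Rightarrow> fb_code \<Rightarrow> (nat \<Rightarrow> nat) \<Rightarrow> (nat \<times> nat \<Rightarrow> real) \<Rightarrow> nat \<times> nat \<Rightarrow> real" where
  "chan_outs K snr T C w z = (\<lambda>(k, t)\<in>{..<K} \<times> {..<T}. chan_out K snr snr C w z k t)"

lemma measurable_chan_outs:
  assumes "fb_measurable K T C" "w \<in> msg_tuples K C"
  shows "chan_outs K snr T C w \<in> (\<Pi>\<^sub>M j\<in>{..<K} \<times> {..<T}. lborel) \<rightarrow>\<^sub>M (\<Pi>\<^sub>M j\<in>{..<K} \<times> {..<T}. lborel)"
  unfolding chan_outs_def[abs_def] case_prod_beta
  using chan_measurable[OF assms] by (intro measurable_restrict) auto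

text \<open>\<open>chan_outs\<close> collects all outputs in a point of the space where the noise
  lives. The shift at \<open>(k, t)\<close> is the signal common to all receivers at time
  \<open>t\<close>, which depends on earlier noise only, so feedback does not change
  volumes.\<close>

lemma nn_integral_chan_outs:
  assumes fb: "fb_measurable K T C" and w: "w \<in> msg_tuples K C"
    and G: "G \<in> borel_measurable (\<Pi>\<^sub>M j\<in>{..<K} \<times> {..<T}. lborel)"
  shows "(\<integral>\<^sup>+ z. G (chan_outs K snr T C w z) \<partial>(\<Pi>\<^sub>M j\<in>{..<K} \<times> {..<T}. lborel))
    = (\<integral>\<^sup>+ y. G y \<partial>(\<Pi>\<^sub>M j\<in>{..<K} \<times> {..<T}. lborel))"
proof -
  let ?I = "{..<K} \<times> {..<T}"
  define a where "a t z = sqrt snr * (\<Sum>i<K. chan_in K snr snr C w z i t)" for t z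
  have Y: "chan_outs K snr T C w z = (\<lambda>j\<in>?I. z j + a (snd j) z)" for z
    by (auto simp: chan_outs_def a_def chan_out_equal_gains fun_eq_iff)
  show ?thesis
    unfolding Y
  proof (rule nn_integral_triangular_shift[where r = snd, OF _ _ _ G])
    show "a (snd j) \<in> borel_measurable (\<Pi>\<^sub>M j\<in>?I. lborel)" if "j \<in> ?I" for j
      using chan_measurable[OF fb w, of "snd j" snr snr] that unfolding a_def[abs_def]
      by (intro borel_measurable_times borel_measurable_sum borel_measurable_const) auto
    show "a (snd j) z = a (snd j) z'"
      if j: "j \<in> ?I" and eq: "\<And>i. i \<in> ?I \<Longrightarrow> snd i < snd j \<Longrightarrow> z i = z' i" for j z z'
    proof -
      have "chan_in K snr snr C w z i (snd j) = chan_in K snr snr C w z' i (snd j)" if "i < K" for i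
      proof (rule chan_in_cong[OF _ that])
        show "z (k, s) = z' (k, s)" if "k < K" "s < snd j" for k s
          by (rule eq) (use that j in auto)
      qed
      then show ?thesis by (simp add: a_def)
    qed
  qed simp
qed

text \<open>The noise law is written as a density, majorised on the event, and then the outputs
  become the variable of integration. On the right the messages enter only through \<open>D\<close>,
  which allows the bounds for different tuples to be added.\<close>

lemma nn_integral_decoded_region_le:
  assumes K: "0 < K" and S: "0 < S" and fb: "fb_measurable K T C" and w: "w \<in> msg_tuples K C"
    and D: "Measurable.pred (\<Pi>\<^sub>M j\<in>{..<K} \<times> {..<T}. lborel) D"
  shows "(\<integral>\<^sup>+ z. indicator {z. D (chan_outs K snr T C w z) \<and> (\<Sum>t<T. (chan_outs K snr T C w z (0, t))\<^sup>2) \<le> S * real T} z \<partial>noise_space K T)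
    \<le> (\<integral>\<^sup>+ y. indicator {y. D y} y * ennreal (out_weight K T S y) \<partial>(\<Pi>\<^sub>M j\<in>{..<K} \<times> {..<T}. lborel))"
proof -
  let ?I = "{..<K} \<times> {..<T}"
  let ?L = "\<Pi>\<^sub>M j\<in>?I. (lborel :: real measure)"
  let ?Y = "chan_outs K snr T C w"
  let ?A = "{z. D (?Y z) \<and> (\<Sum>t<T. (?Y z (0, t))\<^sup>2) \<le> S * real T}"
  have A: "indicator ?A \<in> borel_measurable ?L"
  proof (rule borel_measurable_indicator')
    have "Measurable.pred ?L (\<lambda>z. D (?Y z))"
      by (rule measurable_compose[OF measurable_chan_outs[OF fb w] D])
    moreover have "(\<lambda>z. \<Sum>t<T. (?Y z (0, t))\<^sup>2) \<in> borel_measurable ?L"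
      using K by (intro borel_measurable_sum borel_measurable_power
          measurable_compose[OF measurable_chan_outs[OF fb w] measurable_PiM_lborel_component]) auto
    ultimately show "{z \<in> space ?L. z \<in> ?A} \<in> sets ?L"
      by simp
  qed
  have "(\<integral>\<^sup>+ z. indicator ?A z \<partial>noise_space K T)
      = (\<integral>\<^sup>+ z. (\<Prod>j\<in>?I. ennreal (std_normal_density (z j))) * indicator ?A z \<partial>?L)"
    unfolding noise_space_def
    by (subst PiM_density_lborel)
      (auto intro!: nn_integral_density A borel_measurable_prod_ennreal prob_space_imp_sigma_finite prob_space_std_normal
        measurable_compose[OF measurable_PiM_lborel_component, of _ _ "\<lambda>u. ennreal (std_normal_density u)"])
  also have "\<dots> \<le> (\<integral>\<^sup>+ z. indicator {y. D y} (?Y z) * ennreal (out_weight K T S (?Y z)) \<partial>?L)"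
  proof (intro nn_integral_mono)
    fix z
    show "(\<Prod>j\<in>?I. ennreal (std_normal_density (z j))) * indicator ?A z
        \<le> indicator {y. D y} (?Y z) * ennreal (out_weight K T S (?Y z))"
    proof (cases "z \<in> ?A")
      case True
      have "(\<Prod>j\<in>?I. std_normal_density (z j)) \<le> out_weight K T S (?Y z)"
      proof (rule gaussian_noise_density_le[OF K S])
        show "?Y z (k, t) = z (k, t) + sqrt snr * (\<Sum>i<K. chan_in K snr snr C w z i t)" if "k < K" "t < T" for k t
          using that by (simp add: chan_outs_def chan_out_equal_gains)
      qed (use True in simp)
      with True show ?thesis
        by (simp add: prod_ennreal ennreal_leI)
    qed simp
  qed
  also have "\<dots> = (\<integral>\<^sup>+ y. indicator {y. D y} y * ennreal (out_weight K T S y) \<partial>?L)"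
    using D by (intro nn_integral_chan_outs[OF fb w] borel_measurable_times_ennreal borel_measurable_indicator'
        measurable_compose[OF borel_measurable_out_weight[OF K] measurable_ennreal]) (auto simp: pred_def)
  finally show ?thesis .
qed

lemma pred_decoded_user:
  assumes "fb_measurable K T C" and "k < K"
  shows "Measurable.pred (\<Pi>\<^sub>M j\<in>{..<K} \<times> {..<T}. (lborel :: real measure)) (\<lambda>y. dec C k (\<lambda>t\<in>{..<T}. y (k, t)) = m)"
proof (rule pred_eq_const1)
  let ?L = "\<Pi>\<^sub>M j\<in>{..<K} \<times> {..<T}. (lborel :: real measure)"
  have "(\<lambda>y. \<lambda>t\<in>{..<T}. y (k, t)) \<in> ?L \<rightarrow>\<^sub>M (\<Pi>\<^sub>M s\<in>{..<T}. borel)"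
    using assms(2) by (intro measurable_restrict measurable_PiM_lborel_component) auto
  moreover have "dec C k \<in> (\<Pi>\<^sub>M s\<in>{..<T}. borel) \<rightarrow>\<^sub>M count_space UNIV"
    using assms by (auto simp: fb_measurable_def)
  ultimately show "(\<lambda>y. dec C k (\<lambda>t\<in>{..<T}. y (k, t))) \<in> ?L \<rightarrow>\<^sub>M count_space UNIV"
    by (rule measurable_compose)
qed simp

lemma pred_decoded:
  assumes "fb_measurable K T C"
  shows "Measurable.pred (\<Pi>\<^sub>M j\<in>{..<K} \<times> {..<T}. (lborel :: real measure)) (\<lambda>y. \<forall>k<K. dec C k (\<lambda>t\<in>{..<T}. y (k, t)) = w k)"
proof -
  have "Measurable.pred (\<Pi>\<^sub>M j\<in>{..<K} \<times> {..<T}. (lborel :: real measure)) (\<lambda>y. \<forall>k\<in>{..<K}. dec C k (\<lambda>t\<in>{..<T}. y (k, t)) = w k)"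
    using pred_decoded_user[OF assms] by (intro pred_intros_finite) auto
  then show ?thesis
    unfolding Ball_def lessThan_iff .
qed

lemma out_block_chan_outs:
  "k < K \<Longrightarrow> out_block K snr snr T C w z k = (\<lambda>t\<in>{..<T}. chan_outs K snr T C w z (k, t))"
  by (simp add: out_block_def chan_outs_def cong: restrict_cong)

lemma pred_sample_space_chan_outs:
  assumes msgs: "\<forall>k<K. msgs C k \<ge> 1" and fb: "fb_measurable K T C"
    and D: "\<And>w. Measurable.pred (\<Pi>\<^sub>M j\<in>{..<K} \<times> {..<T}. (lborel :: real measure)) (D w)"
  shows "Measurable.pred (sample_space K T C) (\<lambda>(w, z). D w (chan_outs K snr T C w z))"
  using msgs
proof (rule measurable_sample_space)
  fix w assume w: "w \<in> msg_tuples K C"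
  show "(\<lambda>z. case (w, z) of (w, z) \<Rightarrow> D w (chan_outs K snr T C w z)) \<in> noise_space K T \<rightarrow>\<^sub>M count_space UNIV"
    unfolding measurable_cong_sets[OF sets_noise_space refl] prod.case
    by (rule measurable_compose[OF measurable_chan_outs[OF fb w] D])
qed

lemma pred_output_power:
  assumes "0 < K"
  shows "Measurable.pred (\<Pi>\<^sub>M j\<in>{..<K} \<times> {..<T}. (lborel :: real measure)) (\<lambda>y. (\<Sum>t<T. (y (0, t))\<^sup>2) \<le> c)"
proof -
  have "(\<lambda>y. \<Sum>t<T. (y (0, t))\<^sup>2) \<in> borel_measurable (\<Pi>\<^sub>M j\<in>{..<K} \<times> {..<T}. (lborel :: real measure))"
    using assms by (intro borel_measurable_sum borel_measurable_power measurable_PiM_lborel_component) auto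
  then show ?thesis
    unfolding pred_def by (rule borel_measurable_le) simp
qed

text \<open>Each \<open>y\<close> decodes to at most one tuple, so the bounds of
  \<open>nn_integral_decoded_region_le\<close> add up to at most one integral of
  \<open>out_weight\<close>. The uniform prior supplies the division by the number of
  tuples.\<close>

lemma prob_correct_bounded_output_le:
  assumes K: "0 < K" and S: "0 < S" and msgs: "\<forall>k<K. msgs C k \<ge> 1" and fb: "fb_measurable K T C"
  shows "measure (sample_space K T C) {x \<in> space (sample_space K T C). case x of (w, z) \<Rightarrow>
      (\<forall>k<K. dec C k (out_block K snr snr T C w z k) = w k) \<and> (\<Sum>t<T. (chan_outs K snr T C w z (0, t))\<^sup>2) \<le> S * real T}
    \<le> (sqrt (exp 1 * S) * sqrt (2 * real K + 2) ^ (K - 1)) ^ T / (\<Prod>k<K. real (msgs C k))"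
proof -
  let ?I = "{..<K} \<times> {..<T}"
  let ?L = "\<Pi>\<^sub>M j\<in>?I. (lborel :: real measure)"
  let ?P = "sample_space K T C"
  let ?E = "\<lambda>(w, z). (\<forall>k<K. dec C k (out_block K snr snr T C w z k) = w k) \<and> (\<Sum>t<T. (chan_outs K snr T C w z (0, t))\<^sup>2) \<le> S * real T"
  let ?H = "\<lambda>y. ennreal (out_weight K T S y)"
  let ?b = "(sqrt (exp 1 * S) * sqrt (2 * real K + 2) ^ (K - 1)) ^ T"
  define D where "D w y \<longleftrightarrow> (\<forall>k<K. dec C k (\<lambda>t\<in>{..<T}. y (k, t)) = w k)" for w :: "nat \<Rightarrow> nat" and y :: "nat \<times> nat \<Rightarrow> real"
  define M where "M = (\<Prod>k<K. real (msgs C k))"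
  have M: "M > 0"
    using msgs unfolding M_def by (intro prod_pos) (auto simp: Suc_le_eq)
  have D: "Measurable.pred ?L (D w)" for w
    unfolding D_def[abs_def] by (rule pred_decoded[OF fb])
  have H: "?H \<in> borel_measurable ?L"
    by (rule measurable_compose[OF borel_measurable_out_weight[OF K] measurable_ennreal])
  have DH: "(\<lambda>y. indicator {y. D w y} y * ?H y) \<in> borel_measurable ?L" for w
    using D[of w] by (intro borel_measurable_times_ennreal borel_measurable_indicator' H) (auto simp: pred_def)
  have E: "?E (w, z) \<longleftrightarrow> D w (chan_outs K snr T C w z) \<and> (\<Sum>t<T. (chan_outs K snr T C w z (0, t))\<^sup>2) \<le> S * real T" for w z
    by (simp add: D_def out_block_chan_outs)
  have Em: "{x \<in> space ?P. ?E x} \<in> sets ?P"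
  proof -
    have "Measurable.pred ?L (\<lambda>y. D w y \<and> (\<Sum>t<T. (y (0, t))\<^sup>2) \<le> S * real T)" for w
      using D pred_output_power[OF K] by (rule pred_intros_logic)
    from pred_sample_space_chan_outs[OF msgs fb this, where snr = snr]
    have "{x \<in> space ?P. (\<lambda>(w, z). D w (chan_outs K snr T C w z) \<and> (\<Sum>t<T. (chan_outs K snr T C w z (0, t))\<^sup>2) \<le> S * real T) x} \<in> sets ?P"
      unfolding pred_def .
    also have "(\<lambda>(w, z). D w (chan_outs K snr T C w z) \<and> (\<Sum>t<T. (chan_outs K snr T C w z (0, t))\<^sup>2) \<le> S * real T) = ?E"
      using E by (intro ext) (simp only: split_paired_all prod.case)
    finally show ?thesis .
  qed
  have "emeasure ?P {x \<in> space ?P. ?E x} = (\<integral>\<^sup>+ x. indicator {x \<in> space ?P. ?E x} x \<partial>?P)"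
    using Em by (rule nn_integral_indicator[symmetric])
  also have "\<dots> = (\<integral>\<^sup>+ x. indicator {x. ?E x} x \<partial>?P)"
    by (intro nn_integral_cong) (simp add: indicator_def)
  also have "\<dots> = ennreal (1 / M) * (\<Sum>w\<in>msg_tuples K C. \<integral>\<^sup>+ z. indicator {x. ?E x} (w, z) \<partial>noise_space K T)"
    unfolding M_def
    by (rule nn_integral_sample_space[OF msgs borel_measurable_indicator']) (use Em in \<open>simp only: mem_Collect_eq\<close>)
  also have "\<dots> \<le> ennreal (1 / M) * (\<Sum>w\<in>msg_tuples K C. \<integral>\<^sup>+ y. indicator {y. D w y} y * ?H y \<partial>?L)"
  proof (intro mult_left_mono sum_mono)
    fix w assume w: "w \<in> msg_tuples K C"
    show "(\<integral>\<^sup>+ z. indicator {x. ?E x} (w, z) \<partial>noise_space K T) \<le> (\<integral>\<^sup>+ y. indicator {y. D w y} y * ?H y \<partial>?L)"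
      using nn_integral_decoded_region_le[OF K S fb w D[of w], of snr]
      unfolding indicator_def mem_Collect_eq E .
  qed simp
  also have "(\<Sum>w\<in>msg_tuples K C. \<integral>\<^sup>+ y. indicator {y. D w y} y * ?H y \<partial>?L)
      = (\<integral>\<^sup>+ y. (\<Sum>w\<in>msg_tuples K C. indicator {y. D w y} y * ?H y) \<partial>?L)"
    using DH by (intro nn_integral_sum[symmetric])
  also have "\<dots> \<le> (\<integral>\<^sup>+ y. ?H y \<partial>?L)"
  proof (intro nn_integral_mono)
    fix y
    \<comment> \<open>Message tuples are extensional, so agreement on the users below
      \<open>K\<close> is equality.\<close>
    have eq: "w = w'" if "w \<in> msg_tuples K C" "w' \<in> msg_tuples K C" "D w y" "D w' y" for w w'
      using that unfolding msg_tuples_def by (intro PiE_ext[of w _ _ w']) (auto simp: D_def)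
    have "card {w \<in> msg_tuples K C. D w y} \<le> Suc 0"
      using eq finite_msg_tuples[of K C] by (subst card_le_Suc0_iff_eq) auto
    then have "of_nat (card {w \<in> msg_tuples K C. D w y}) * ?H y \<le> 1 * ?H y"
      by (intro mult_right_mono) (auto simp: le_Suc_eq)
    moreover have "(\<Sum>w\<in>msg_tuples K C. indicator {y. D w y} y * ?H y) = of_nat (card {w \<in> msg_tuples K C. D w y}) * ?H y"
      using finite_msg_tuples[of K C]
      by (simp add: sum_distrib_right[symmetric] indicator_def sum.If_cases Collect_conj_eq)
    ultimately show "(\<Sum>w\<in>msg_tuples K C. indicator {y. D w y} y * ?H y) \<le> ?H y"
      by simp
  qed
  also have "(\<integral>\<^sup>+ y. ?H y \<partial>?L) = ennreal ?b"
    by (rule nn_integral_out_weight[OF K S])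
  also have "ennreal (1 / M) * \<dots> = ennreal (?b / M)"
    using M by (simp add: ennreal_mult'[symmetric])
  finally have "emeasure ?P {x \<in> space ?P. ?E x} \<le> ennreal (?b / M)"
    by (simp add: mult_left_mono)
  then have "measure ?P {x \<in> space ?P. ?E x} \<le> ?b / M"
    using M S unfolding measure_def by (intro enn2real_leI) simp_all
  then show ?thesis
    unfolding M_def .
qed

section \<open>Output power and the rate bound\<close>

lemma power_sum_le:
  assumes "power_constraint K snr inr T C" "k < K" "1 \<le> T"
  shows "(\<Sum>t<T. \<integral>x. (case x of (w, z) \<Rightarrow> (chan_in K snr inr C w z k t)\<^sup>2) \<partial>sample_space K T C) \<le> real T"
  using assms by (simp add: power_constraint_def field_simps)

text \<open>Feedback can correlate the inputs, so the square of their sum is bounded by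
  Cauchy-Schwarz, which accounts for the square of \<open>K\<close>. The inequality (u + v)^2 <= 2
  u^2 + 2 v^2 splits off the noise without appeal to independence; the factor 2 it loses does not
  grow with \<open>snr\<close>.\<close>

lemma nn_integral_output_power_le:
  assumes K: "0 < K" and T: "1 \<le> T" and snr: "0 < snr" and valid: "fb_code_valid K snr snr T C"
  shows "(\<integral>\<^sup>+ (w, z). ennreal (\<Sum>t<T. (chan_outs K snr T C w z (0, t))\<^sup>2) \<partial>sample_space K T C)
    \<le> ennreal (real T * (2 * snr * (real K)\<^sup>2 + 2))"
proof -
  let ?P = "sample_space K T C"
  have msgs: "\<forall>k<K. msgs C k \<ge> 1" and fb: "fb_measurable K T C" and pow: "power_constraint K snr snr T C"
    using valid by (auto simp: fb_code_valid_def)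
  define X where "X k t = (\<lambda>(w, z). (chan_in K snr snr C w z k t)\<^sup>2)" for k t
  define N where "N t = (\<lambda>(w :: nat \<Rightarrow> nat, z :: nat \<times> nat \<Rightarrow> real). ennreal ((z (0, t))\<^sup>2))" for t :: nat
  have X: "integrable ?P (X k t)" if "k < K" "t < T" for k t
    using pow that by (simp add: power_constraint_def X_def)
  have Xm: "(\<lambda>x. ennreal (X k t x)) \<in> borel_measurable ?P" if "k < K" "t < T" for k t
    using X[OF that] by (intro measurable_compose[OF borel_measurable_integrable measurable_ennreal])
  have X0: "0 \<le> X k t x" for k t x
    by (simp add: X_def split: prod.split)
  have Nm: "N t \<in> borel_measurable ?P" if "t < T" for t
    using msgs unfolding N_def
  proof (rule measurable_sample_space)
    fix w
    have "(\<lambda>z. z (0, t)) \<in> borel_measurable (noise_space K T)"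
      unfolding measurable_cong_sets[OF sets_noise_space refl]
      using K that by (intro measurable_PiM_lborel_component) auto
    then show "(\<lambda>z. case (w, z) of (w, z) \<Rightarrow> ennreal ((z (0, t))\<^sup>2)) \<in> borel_measurable (noise_space K T)"
      by simp
  qed
  have le: "(case x of (w, z) \<Rightarrow> ennreal (\<Sum>t<T. (chan_outs K snr T C w z (0, t))\<^sup>2))
      \<le> (\<Sum>t<T. ennreal (2 * snr * real K) * (\<Sum>k<K. ennreal (X k t x)) + 2 * N t x)" for x
  proof (cases x)
    case (Pair w z)
    have "(chan_outs K snr T C w z (0, t))\<^sup>2 \<le> 2 * snr * real K * (\<Sum>k<K. X k t x) + 2 * (z (0, t))\<^sup>2" if t: "t < T" for t
    proof -
      let ?s = "\<Sum>k<K. chan_in K snr snr C w z k t"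
      have "(chan_outs K snr T C w z (0, t))\<^sup>2 = (z (0, t) + sqrt snr * ?s)\<^sup>2"
        using K t by (simp add: chan_outs_def chan_out_equal_gains)
      also have "\<dots> \<le> 2 * (z (0, t))\<^sup>2 + 2 * (sqrt snr * ?s)\<^sup>2"
        using zero_le_power2[of "z (0, t) - sqrt snr * ?s"] unfolding power2_sum power2_diff by linarith
      also have "(sqrt snr * ?s)\<^sup>2 = snr * ?s\<^sup>2"
        using snr by (simp add: power_mult_distrib)
      also have "?s\<^sup>2 \<le> real K * (\<Sum>k<K. X k t x)"
        using Cauchy_Schwarz_ineq_sum[of "\<lambda>_. 1" "\<lambda>k. chan_in K snr snr C w z k t" "{..<K}"] by (simp add: X_def Pair)
      finally show ?thesis using snr by (simp add: mult_left_mono algebra_simps)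
    qed
    then have "(\<Sum>t<T. (chan_outs K snr T C w z (0, t))\<^sup>2) \<le> (\<Sum>t<T. 2 * snr * real K * (\<Sum>k<K. X k t x) + 2 * (z (0, t))\<^sup>2)"
      by (intro sum_mono) simp
    then have "ennreal (\<Sum>t<T. (chan_outs K snr T C w z (0, t))\<^sup>2)
        \<le> ennreal (\<Sum>t<T. 2 * snr * real K * (\<Sum>k<K. X k t x) + 2 * (z (0, t))\<^sup>2)"
      by (rule ennreal_leI)
    also have "\<dots> = (\<Sum>t<T. ennreal (2 * snr * real K * (\<Sum>k<K. X k t x) + 2 * (z (0, t))\<^sup>2))"
      using snr X0 by (intro sum_ennreal[symmetric]) (simp add: sum_nonneg)
    also have "\<dots> = (\<Sum>t<T. ennreal (2 * snr * real K) * (\<Sum>k<K. ennreal (X k t x)) + 2 * N t x)"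
      using snr X0 by (intro sum.cong refl) (simp add: sum_nonneg ennreal_mult' sum_ennreal N_def Pair)
    finally show ?thesis
      by (simp add: Pair)
  qed
  have "(\<integral>\<^sup>+ (w, z). ennreal (\<Sum>t<T. (chan_outs K snr T C w z (0, t))\<^sup>2) \<partial>?P)
      \<le> (\<integral>\<^sup>+ x. (\<Sum>t<T. ennreal (2 * snr * real K) * (\<Sum>k<K. ennreal (X k t x)) + 2 * N t x) \<partial>?P)"
    by (intro nn_integral_mono le)
  also have "\<dots> = (\<Sum>t<T. \<integral>\<^sup>+ x. ennreal (2 * snr * real K) * (\<Sum>k<K. ennreal (X k t x)) + 2 * N t x \<partial>?P)"
    using Xm Nm by (intro nn_integral_sum borel_measurable_add borel_measurable_times_ennreal borel_measurable_const borel_measurable_sum) auto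
  also have "\<dots> = (\<Sum>t<T. ennreal (2 * snr * real K) * (\<Sum>k<K. \<integral>\<^sup>+ x. ennreal (X k t x) \<partial>?P) + 2 * (\<integral>\<^sup>+ x. N t x \<partial>?P))"
  proof (intro sum.cong refl)
    fix t assume "t \<in> {..<T}"
    then have t: "t < T" by simp
    have sum: "(\<lambda>x. \<Sum>k<K. ennreal (X k t x)) \<in> borel_measurable ?P"
      using Xm t by (intro borel_measurable_sum) auto
    have "(\<integral>\<^sup>+ x. ennreal (2 * snr * real K) * (\<Sum>k<K. ennreal (X k t x)) + 2 * N t x \<partial>?P)
        = (\<integral>\<^sup>+ x. ennreal (2 * snr * real K) * (\<Sum>k<K. ennreal (X k t x)) \<partial>?P) + (\<integral>\<^sup>+ x. 2 * N t x \<partial>?P)"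
      using sum Nm[OF t] by (intro nn_integral_add borel_measurable_times_ennreal borel_measurable_const)
    also have "\<dots> = ennreal (2 * snr * real K) * (\<integral>\<^sup>+ x. (\<Sum>k<K. ennreal (X k t x)) \<partial>?P) + 2 * (\<integral>\<^sup>+ x. N t x \<partial>?P)"
      unfolding nn_integral_cmult[OF sum] nn_integral_cmult[OF Nm[OF t]] ..
    also have "(\<integral>\<^sup>+ x. (\<Sum>k<K. ennreal (X k t x)) \<partial>?P) = (\<Sum>k<K. \<integral>\<^sup>+ x. ennreal (X k t x) \<partial>?P)"
      using Xm t by (intro nn_integral_sum) auto
    finally show "(\<integral>\<^sup>+ x. ennreal (2 * snr * real K) * (\<Sum>k<K. ennreal (X k t x)) + 2 * N t x \<partial>?P)
        = ennreal (2 * snr * real K) * (\<Sum>k<K. \<integral>\<^sup>+ x. ennreal (X k t x) \<partial>?P) + 2 * (\<integral>\<^sup>+ x. N t x \<partial>?P)" .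
  qed
  also have "\<dots> = (\<Sum>t<T. ennreal (2 * snr * real K) * (\<Sum>k<K. ennreal (\<integral>x. X k t x \<partial>?P)) + 2)"
    using K nn_integral_noise_power[OF msgs] X0
    by (intro sum.cong refl) (simp add: N_def nn_integral_eq_integral X)
  also have "\<dots> = (\<Sum>t<T. ennreal (2 * snr * real K * (\<Sum>k<K. \<integral>x. X k t x \<partial>?P) + 2))"
    using snr X0 by (intro sum.cong refl) (simp add: sum_nonneg ennreal_mult' sum_ennreal)
  also have "\<dots> = ennreal (\<Sum>t<T. 2 * snr * real K * (\<Sum>k<K. \<integral>x. X k t x \<partial>?P) + 2)"
    using snr X0 by (intro sum_ennreal) (simp add: sum_nonneg)
  also have "(\<Sum>t<T. 2 * snr * real K * (\<Sum>k<K. \<integral>x. X k t x \<partial>?P) + 2)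
      = 2 * snr * real K * (\<Sum>k<K. \<Sum>t<T. \<integral>x. X k t x \<partial>?P) + 2 * real T"
    by (subst sum.swap) (simp add: sum.distrib sum_distrib_left)
  also have "ennreal \<dots> \<le> ennreal (2 * snr * real K * (\<Sum>k<K. real T) + 2 * real T)"
    using snr power_sum_le[OF pow _ T]
    by (intro ennreal_leI add_right_mono mult_left_mono sum_mono) (auto simp: X_def)
  also have "2 * snr * real K * (\<Sum>k<K. real T) + 2 * real T = real T * (2 * snr * (real K)\<^sup>2 + 2)"
    by (simp add: power2_eq_square algebra_simps)
  finally show ?thesis .
qed

text \<open>\<open>S\<close> is twice the bound on the mean output power per channel use in
  \<open>nn_integral_output_power_le\<close>, so Markov's inequality gives exactly 1 / 2.\<close>

lemma prob_large_output_le: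
  assumes K: "0 < K" and T: "1 \<le> T" and snr: "0 < snr" and valid: "fb_code_valid K snr snr T C"
    and S: "S = 4 * (snr * (real K)\<^sup>2 + 1)"
  shows "measure (sample_space K T C)
    {x \<in> space (sample_space K T C). \<not> (case x of (w, z) \<Rightarrow> (\<Sum>t<T. (chan_outs K snr T C w z (0, t))\<^sup>2) \<le> S * real T)} \<le> 1 / 2"
proof -
  let ?P = "sample_space K T C"
  let ?u = "\<lambda>(w, z). \<Sum>t<T. (chan_outs K snr T C w z (0, t))\<^sup>2"
  have msgs: "\<forall>k<K. msgs C k \<ge> 1" and fb: "fb_measurable K T C"
    using valid by (auto simp: fb_code_valid_def)
  have S0: "S > 0" using S snr by (simp add: add_nonneg_pos)
  have T0: "real T > 0" using T by simp
  have u: "(\<lambda>x. ennreal (?u x)) \<in> borel_measurable ?P"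
  \<comment> \<open>Measurability is reduced to sublevel sets, which are the events that
    \<open>pred_output_power\<close> covers.\<close>
  proof (rule measurable_compose[OF _ measurable_ennreal], rule borel_measurable_iff_le[THEN iffD2], rule allI)
    fix c
    have "{x \<in> space ?P. ?u x \<le> c} = {x \<in> space ?P. case x of (w, z) \<Rightarrow> (\<Sum>t<T. (chan_outs K snr T C w z (0, t))\<^sup>2) \<le> c}"
      by auto
    also have "\<dots> \<in> sets ?P"
      using pred_sample_space_chan_outs[OF msgs fb pred_output_power[OF K]] unfolding pred_def .
    finally show "{x \<in> space ?P. ?u x \<le> c} \<in> sets ?P" .
  qed
  have "emeasure ?P {x \<in> space ?P. \<not> (case x of (w, z) \<Rightarrow> (\<Sum>t<T. (chan_outs K snr T C w z (0, t))\<^sup>2) \<le> S * real T)}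
      \<le> emeasure ?P {x \<in> space ?P. 1 \<le> ennreal (1 / (S * real T)) * ennreal (?u x)}"
  proof (rule emeasure_mono)
    show "{x \<in> space ?P. 1 \<le> ennreal (1 / (S * real T)) * ennreal (?u x)} \<in> sets ?P"
      using u by measurable
    show "{x \<in> space ?P. \<not> (case x of (w, z) \<Rightarrow> (\<Sum>t<T. (chan_outs K snr T C w z (0, t))\<^sup>2) \<le> S * real T)}
      \<subseteq> {x \<in> space ?P. 1 \<le> ennreal (1 / (S * real T)) * ennreal (?u x)}"
    proof clarify
      fix w z
      assume "\<not> (\<Sum>t<T. (chan_outs K snr T C w z (0, t))\<^sup>2) \<le> S * real T"
      then have "1 \<le> 1 / (S * real T) * (\<Sum>t<T. (chan_outs K snr T C w z (0, t))\<^sup>2)"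
        using S0 T0 by (simp add: field_simps)
      then have "ennreal 1 \<le> ennreal (1 / (S * real T) * (\<Sum>t<T. (chan_outs K snr T C w z (0, t))\<^sup>2))"
        by (rule ennreal_leI)
      then show "1 \<le> ennreal (1 / (S * real T)) * ennreal (\<Sum>t<T. (chan_outs K snr T C w z (0, t))\<^sup>2)"
        using S0 T0 by (subst ennreal_mult'[symmetric]) simp_all
    qed
  qed
  also have "\<dots> \<le> ennreal (1 / (S * real T)) * (\<integral>\<^sup>+ x. ennreal (?u x) * indicator (space ?P) x \<partial>?P)"
    using u by (intro nn_integral_Markov_inequality) auto
  also have "(\<integral>\<^sup>+ x. ennreal (?u x) * indicator (space ?P) x \<partial>?P) = (\<integral>\<^sup>+ (w, z). ennreal (\<Sum>t<T. (chan_outs K snr T C w z (0, t))\<^sup>2) \<partial>?P)"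
    by (intro nn_integral_cong) (simp split: prod.split)
  also have "ennreal (1 / (S * real T)) * \<dots> \<le> ennreal (1 / (S * real T)) * ennreal (real T * (2 * snr * (real K)\<^sup>2 + 2))"
    by (intro mult_left_mono nn_integral_output_power_le[OF K T snr valid]) simp
  also have "\<dots> = ennreal (1 / (S * real T) * (real T * (2 * snr * (real K)\<^sup>2 + 2)))"
    using S0 T0 by (intro ennreal_mult'[symmetric]) simp
  also have "1 / (S * real T) * (real T * (2 * snr * (real K)\<^sup>2 + 2)) = 1 / 2"
  proof -
    have "real T * (2 * snr * (real K)\<^sup>2 + 2) = S * real T * (1 / 2)"
      unfolding S by (simp add: algebra_simps)
    then show ?thesis using S0 T0 by simp
  qed
  finally show ?thesis
    unfolding measure_def by (intro enn2real_leI) simp_all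
qed

text \<open>Three events cover the sample space: some user errs, the output of user 0 has large
  power, or everything is decoded correctly with bounded output power. The three terms bound their
  probabilities.\<close>

lemma converse_ineq:
  assumes K: "0 < K" and T: "1 \<le> T" and snr: "0 < snr" and valid: "fb_code_valid K snr snr T C"
    and S: "S = 4 * (snr * (real K)\<^sup>2 + 1)"
  shows "1 \<le> (\<Sum>k<K. error_prob K snr snr T C k) + 1 / 2
    + (sqrt (exp 1 * S) * sqrt (2 * real K + 2) ^ (K - 1)) ^ T / (\<Prod>k<K. real (msgs C k))"
proof -
  let ?P = "sample_space K T C"
  have msgs: "\<forall>k<K. msgs C k \<ge> 1" and fb: "fb_measurable K T C"
    using valid by (auto simp: fb_code_valid_def)
  interpret prob_space ?P by (rule prob_space_sample_space[OF msgs])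
  have S0: "S > 0" using S snr by (simp add: add_nonneg_pos)
  define ok where "ok k = (\<lambda>(w, z). dec C k (out_block K snr snr T C w z k) = w k)" for k
  define small where "small = (\<lambda>(w, z). (\<Sum>t<T. (chan_outs K snr T C w z (0, t))\<^sup>2) \<le> S * real T)"
  have ok: "{x \<in> space ?P. \<not> ok k x} \<in> sets ?P" if k: "k < K" for k
  proof -
    have "Measurable.pred ?P (ok k)"
      using pred_sample_space_chan_outs[OF msgs fb pred_decoded_user[OF fb k]]
      unfolding ok_def out_block_chan_outs[OF k] .
    then show ?thesis unfolding pred_def[symmetric] by (rule pred_intros_logic)
  qed
  have small: "Measurable.pred ?P small"
    unfolding small_def by (rule pred_sample_space_chan_outs[OF msgs fb pred_output_power[OF K]])
  have nsmall: "{x \<in> space ?P. \<not> small x} \<in> sets ?P"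
    using small unfolding pred_def[symmetric] by (rule pred_intros_logic)
  have "{x \<in> space ?P. (\<forall>k<K. ok k x) \<and> small x}
      = space ?P - ((\<Union>k\<in>{..<K}. {x \<in> space ?P. \<not> ok k x}) \<union> {x \<in> space ?P. \<not> small x})"
    by auto
  also have "\<dots> \<in> sets ?P"
    using ok nsmall by (intro sets.Diff sets.Un sets.finite_UN) auto
  finally have good: "{x \<in> space ?P. (\<forall>k<K. ok k x) \<and> small x} \<in> sets ?P" .
  have bad: "(\<Union>k\<in>{..<K}. {x \<in> space ?P. \<not> ok k x}) \<in> sets ?P"
    using ok by (intro sets.finite_UN finite_lessThan) (simp only: lessThan_iff)
  have "1 = measure ?P (space ?P)"
    by (simp add: prob_space)
  also have "\<dots> \<le> measure ?P ((\<Union>k\<in>{..<K}. {x \<in> space ?P. \<not> ok k x}) \<union> {x \<in> space ?P. \<not> small x}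
      \<union> {x \<in> space ?P. (\<forall>k<K. ok k x) \<and> small x})"
    by (rule finite_measure_mono[OF _ sets.Un[OF sets.Un[OF bad nsmall] good]]) blast
  also have "\<dots> \<le> measure ?P (\<Union>k\<in>{..<K}. {x \<in> space ?P. \<not> ok k x}) + measure ?P {x \<in> space ?P. \<not> small x}
      + measure ?P {x \<in> space ?P. (\<forall>k<K. ok k x) \<and> small x}"
    by (rule order.trans[OF measure_Un_le[OF sets.Un[OF bad nsmall] good] add_right_mono[OF measure_Un_le[OF bad nsmall]]])
  also have "\<dots> \<le> (\<Sum>k<K. error_prob K snr snr T C k) + 1 / 2
    + (sqrt (exp 1 * S) * sqrt (2 * real K + 2) ^ (K - 1)) ^ T / (\<Prod>k<K. real (msgs C k))"
  proof (intro add_mono)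
    have "measure ?P (\<Union>k\<in>{..<K}. {x \<in> space ?P. \<not> ok k x}) \<le> (\<Sum>k<K. measure ?P {x \<in> space ?P. \<not> ok k x})"
      using ok by (intro measure_UNION_le finite_lessThan) (simp only: lessThan_iff)
    also have "\<dots> = (\<Sum>k<K. error_prob K snr snr T C k)"
      unfolding error_prob_def ok_def by (intro sum.cong arg_cong[where f = "measure ?P"]) auto
    finally show "measure ?P (\<Union>k\<in>{..<K}. {x \<in> space ?P. \<not> ok k x}) \<le> (\<Sum>k<K. error_prob K snr snr T C k)" .
    show "measure ?P {x \<in> space ?P. \<not> small x} \<le> 1 / 2"
      unfolding small_def by (rule prob_large_output_le[OF K T snr valid S])
    have "{x \<in> space ?P. (\<forall>k<K. ok k x) \<and> small x} = {x \<in> space ?P. case x of (w, z) \<Rightarrow>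
      (\<forall>k<K. dec C k (out_block K snr snr T C w z k) = w k) \<and> (\<Sum>t<T. (chan_outs K snr T C w z (0, t))\<^sup>2) \<le> S * real T}"
      by (auto simp: ok_def small_def)
    with prob_correct_bounded_output_le[OF K S0 msgs fb, of snr]
    show "measure ?P {x \<in> space ?P. (\<forall>k<K. ok k x) \<and> small x}
      \<le> (sqrt (exp 1 * S) * sqrt (2 * real K + 2) ^ (K - 1)) ^ T / (\<Prod>k<K. real (msgs C k))"
      by simp
  qed
  finally show ?thesis .
qed

text \<open>There are at least 2^(T K R) message tuples, so a larger rate makes the last term of
  \<open>converse_ineq\<close> decay like \<open>q ^ T\<close> with \<open>q < 1\<close>. The error
  terms vanish too, and the limit would read 1 <= 1 / 2.\<close>

lemma achievable_rate_le:
  assumes K: "0 < K" and snr: "0 < snr" and ach: "achievable K snr snr (\<lambda>_. R)"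
  shows "real K * R \<le> log 2 (sqrt (exp 1 * (4 * (snr * (real K)\<^sup>2 + 1))) * sqrt (2 * real K + 2) ^ (K - 1))"
proof (rule ccontr)
  define b where "b = sqrt (exp 1 * (4 * (snr * (real K)\<^sup>2 + 1))) * sqrt (2 * real K + 2) ^ (K - 1)"
  assume "\<not> ?thesis"
  then have "log 2 b < real K * R"
    by (simp add: b_def)
  moreover have b: "b > 0"
    using snr by (simp add: b_def add_nonneg_pos)
  ultimately have less: "b < 2 powr (real K * R)"
    by (simp add: log_less_iff)
  define q where "q = b / 2 powr (real K * R)"
  have q: "0 \<le> q" "q < 1"
    using b less by (simp_all add: q_def)
  from ach obtain C where valid: "\<And>T. 1 \<le> T \<Longrightarrow> fb_code_valid K snr snr T (C T)"
    and size: "\<And>T k. 1 \<le> T \<Longrightarrow> k < K \<Longrightarrow> 2 powr (real T * R) \<le> real (msgs (C T) k)"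
    and err: "\<And>k. k < K \<Longrightarrow> (\<lambda>T. error_prob K snr snr T (C T) k) \<longlonglongrightarrow> 0"
    unfolding achievable_def by blast
  have "1 \<le> (\<Sum>k<K. error_prob K snr snr T (C T) k) + 1 / 2 + q ^ T" if T: "1 \<le> T" for T
  proof -
    have "(2 powr (real K * R)) ^ T = (\<Prod>k<K. 2 powr (real T * R))"
      by (simp add: powr_realpow[symmetric] powr_powr mult_ac flip: powr_power)
    also have "\<dots> \<le> (\<Prod>k<K. real (msgs (C T) k))"
      using size[OF T] by (intro prod_mono) auto
    finally have "b ^ T / (\<Prod>k<K. real (msgs (C T) k)) \<le> b ^ T / (2 powr (real K * R)) ^ T"
      using b by (intro divide_left_mono mult_pos_pos) (auto intro: less_le_trans[rotated])
    then show ?thesis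
      using converse_ineq[OF K T snr valid[OF T] refl] unfolding b_def[symmetric] q_def power_divide by linarith
  qed
  then have "\<forall>\<^sub>F T in sequentially. 1 \<le> (\<Sum>k<K. error_prob K snr snr T (C T) k) + 1 / 2 + q ^ T"
    by (auto simp: eventually_sequentially)
  moreover have "(\<lambda>T. (\<Sum>k<K. error_prob K snr snr T (C T) k) + 1 / 2 + q ^ T) \<longlonglongrightarrow> (\<Sum>k<K. 0) + 1 / 2 + 0"
    using q err by (intro tendsto_add tendsto_sum tendsto_const LIMSEQ_power_zero) auto
  ultimately have "(1::real) \<le> (\<Sum>k<K. 0) + 1 / 2 + 0"
    by (intro tendsto_lowerbound) auto
  then show False by simp
qed

section \<open>Achievability\<close>

text \<open>Horner's scheme in the outputs from time \<open>s0\<close> on: the descending powers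
  make each new output enter as in \<open>fb_sum_Suc\<close>, after the old value has been
  multiplied by \<open>a\<close>.\<close>

definition fb_sum :: "real \<Rightarrow> nat \<Rightarrow> nat \<Rightarrow> (nat \<Rightarrow> real) \<Rightarrow> real" where
  "fb_sum a s0 s y = (\<Sum>r<s. a ^ (s - 1 - r) * y (s0 + r))"

text \<open>At offset \<open>s\<close> of a turn the accumulated output should be
  \<open>a ^ s\<close> times the message point. The encoder sends the shortfall, computed from its
  own outputs alone; at offset 0 this is the message point itself. The decoder rescales and rounds
  to the nearest integer, hence the summand 1 / 2 under the floor.\<close>

definition tdma_code :: "real \<Rightarrow> nat \<Rightarrow> nat \<Rightarrow> fb_code" where
  "tdma_code a n M = \<lparr>msgs = (\<lambda>_. M),
     enc = (\<lambda>k t m y. if t \<in> {k * n..<k * n + n}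
        then a ^ (t - k * n) * (real m / real M) - fb_sum a (k * n) (t - k * n) y else 0),
     dec = (\<lambda>k y. nat \<lfloor>real M * fb_sum a (k * n) n y / a ^ n + 1 / 2\<rfloor>)\<rparr>"

lemma msgs_tdma_code [simp]: "msgs (tdma_code a n M) k = M"
  by (simp add: tdma_code_def)

lemma fb_sum_0 [simp]: "fb_sum a s0 0 y = 0"
  by (simp add: fb_sum_def)

lemma fb_sum_Suc: "fb_sum a s0 (Suc s) y = a * fb_sum a s0 s y + y (s0 + s)"
proof -
  have "a ^ (s - r) * y (s0 + r) = a * (a ^ (s - 1 - r) * y (s0 + r))" if "r < s" for r
    using that by (cases s) (simp_all add: Suc_diff_le)
  then have "(\<Sum>r<s. a ^ (s - r) * y (s0 + r)) = (\<Sum>r<s. a * (a ^ (s - 1 - r) * y (s0 + r)))"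
    by (intro sum.cong) simp_all
  then show ?thesis
    by (simp add: fb_sum_def sum_distrib_left)
qed

lemma fb_sum_restrict:
  "s0 + s \<le> t \<Longrightarrow> fb_sum a s0 s (restrict y {..<t}) = fb_sum a s0 s y"
  by (simp add: fb_sum_def)

lemma borel_measurable_fb_sum:
  assumes "s0 + s \<le> t"
  shows "fb_sum a s0 s \<in> borel_measurable (\<Pi>\<^sub>M i\<in>{..<t}. borel)"
  unfolding fb_sum_def[abs_def]
  using assms by (intro borel_measurable_sum borel_measurable_times borel_measurable_const measurable_component_singleton) auto

context
  fixes K n M T :: nat and snr a :: real and C :: fb_code
  assumes nT: "n * K \<le> T" and M: "1 \<le> M" and snr: "0 < snr"
  defines "a \<equiv> sqrt snr" and "C \<equiv> tdma_code (sqrt snr) n M"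
begin

lemma tdma_chan_in:
  "chan_in K snr snr C w z k t = (if t \<in> {k * n..<k * n + n}
     then a ^ (t - k * n) * (real (w k) / real M) - fb_sum a (k * n) (t - k * n) (\<lambda>s. chan_out K snr snr C w z k s) else 0)"
  by (simp add: chan_in.simps C_def tdma_code_def a_def fb_sum_restrict)

text \<open>Turns of different users are disjoint intervals, so nobody else transmits during the
  turn of user \<open>k\<close>.\<close>

lemma tdma_chan_out:
  assumes "k < K" and t: "t \<in> {k * n..<k * n + n}"
  shows "chan_out K snr snr C w z k t = a * chan_in K snr snr C w z k t + z (k, t)"
proof -
  have "chan_in K snr snr C w z i t = 0" if "i \<noteq> k" for i
  proof -
    have "t \<notin> {i * n..<i * n + n}"
    proof (cases "i < k")
      case True
      then have "(i + 1) * n \<le> k * n" by (intro mult_le_mono1) simp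
      then show ?thesis using t by simp
    next
      case False
      then have "(k + 1) * n \<le> i * n" using that by (intro mult_le_mono1) simp
      then show ?thesis using t by simp
    qed
    then show ?thesis by (simp only: tdma_chan_in if_False)
  qed
  then show ?thesis by (simp add: chan_out.simps a_def)
qed

text \<open>The accumulated output carries the message, amplified by the gain of every slot, and only the
  most recent noise: each input after the first one cancels the noise of the preceding slot.\<close>

lemma tdma_fb_sum:
  assumes "k < K" "s < n"
  shows "fb_sum a (k * n) (Suc s) (\<lambda>s. chan_out K snr snr C w z k s)
    = a ^ Suc s * (real (w k) / real M) + z (k, k * n + s)"
  unfolding fb_sum_Suc using assms
  by (subst tdma_chan_out) (simp_all add: tdma_chan_in algebra_simps)

text \<open>Hence the input has second moment 1 whatever the gain, as the power constraint
  requires.\<close>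

lemma tdma_chan_in_Suc:
  assumes "k < K" "Suc s < n"
  shows "chan_in K snr snr C w z k (k * n + Suc s) = - z (k, k * n + s)"
  using assms tdma_fb_sum[of k s w z] by (simp add: tdma_chan_in)

lemma tdma_slot_less: "k < K \<Longrightarrow> k * n + n \<le> T"
  using nT mult_le_mono1[of "k + 1" K n] by (simp add: mult.commute)

lemma tdma_measurable: "fb_measurable K T C"
  unfolding fb_measurable_def
proof (intro conjI allI impI)
  fix k t m assume "k < K" "t < T"
  show "enc C k t m \<in> borel_measurable (\<Pi>\<^sub>M s\<in>{..<t}. borel)"
  proof (cases "t \<in> {k * n..<k * n + n}")
    case True
    then have "enc C k t m = (\<lambda>y. a ^ (t - k * n) * (real m / real M) - fb_sum a (k * n) (t - k * n) y)"
      by (simp add: C_def tdma_code_def a_def)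
    then show ?thesis
      using True by (simp add: borel_measurable_fb_sum borel_measurable_diff)
  next
    case False
    then have "enc C k t m = (\<lambda>y. 0)"
      by (auto simp add: C_def tdma_code_def)
    then show ?thesis by simp
  qed
next
  fix k assume k: "k < K"
  have "(\<lambda>y. real M * fb_sum a (k * n) n y / a ^ n + 1 / 2) \<in> borel_measurable (\<Pi>\<^sub>M s\<in>{..<T}. borel)"
    by (intro borel_measurable_add borel_measurable_divide borel_measurable_times borel_measurable_const
        borel_measurable_fb_sum tdma_slot_less k)
  from measurable_compose[OF this measurable_compose[OF measurable_real_floor, of nat "count_space UNIV"]]
  have "(\<lambda>y. nat \<lfloor>real M * fb_sum a (k * n) n y / a ^ n + 1 / 2\<rfloor>) \<in> (\<Pi>\<^sub>M s\<in>{..<T}. borel) \<rightarrow>\<^sub>M count_space UNIV"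
    by simp
  then show "dec C k \<in> (\<Pi>\<^sub>M s\<in>{..<T}. borel) \<rightarrow>\<^sub>M count_space UNIV"
    by (simp add: C_def tdma_code_def a_def)
qed

lemma tdma_msgs: "\<forall>k<K. msgs C k \<ge> 1"
  using M by (simp add: C_def)

text \<open>The constraint holds in each slot separately: the first slot of a turn carries a number
  in [0,1), later ones carry a negated standard normal noise, and outside the turn the input is
  0.\<close>

lemma tdma_input_power:
  assumes k: "k < K" and t: "t < T"
  shows "integrable (sample_space K T C) (\<lambda>(w, z). (chan_in K snr snr C w z k t)\<^sup>2)"
    and "(\<integral>(w, z). (chan_in K snr snr C w z k t)\<^sup>2 \<partial>sample_space K T C) \<le> 1"
proof -
  let ?P = "sample_space K T C"
  let ?f = "\<lambda>(w, z). (chan_in K snr snr C w z k t)\<^sup>2"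
  interpret prob_space ?P by (rule prob_space_sample_space[OF tdma_msgs])
  have meas: "?f \<in> borel_measurable ?P"
    using tdma_msgs
  proof (rule measurable_sample_space)
    fix w assume w: "w \<in> msg_tuples K C"
    show "(\<lambda>z. case (w, z) of (w, z) \<Rightarrow> (chan_in K snr snr C w z k t)\<^sup>2) \<in> borel_measurable (noise_space K T)"
      unfolding measurable_cong_sets[OF sets_noise_space refl] prod.case
      using chan_measurable[OF tdma_measurable w t] k by (intro borel_measurable_power) blast
  qed
  have nonneg: "0 \<le> ?f x" for x
    by (simp split: prod.split)
  have le: "(\<integral>\<^sup>+ x. ennreal (?f x) \<partial>?P) \<le> 1"
  proof (cases "\<exists>s. t = k * n + Suc s \<and> Suc s < n")
    case True
    then obtain s where s: "t = k * n + Suc s" "Suc s < n" by blast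
    have "(\<integral>\<^sup>+ x. ennreal (?f x) \<partial>?P) = (\<integral>\<^sup>+ (w, z). ennreal ((z (k, k * n + s))\<^sup>2) \<partial>?P)"
      unfolding s(1) tdma_chan_in_Suc[OF k s(2)] by (intro nn_integral_cong) (simp split: prod.split)
    also have "\<dots> = 1"
      using k t s by (intro nn_integral_noise_power tdma_msgs) auto
    finally show ?thesis by simp
  next
    case False
    have "?f x \<le> 1" if x: "x \<in> space ?P" for x
    proof (cases x)
      case (Pair w z)
      then have "w k < M"
        using x k by (auto simp: sample_space_def space_pair_measure space_PiM space_uniform_count_measure C_def)
      then have "real (w k) / real M \<le> 1" by simp
      moreover have "chan_in K snr snr C w z k t = 0 \<or> chan_in K snr snr C w z k t = real (w k) / real M"
      proof (cases "t \<in> {k * n..<k * n + n}")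
        case True
        then obtain r where "t = k * n + r" "r < n"
          by (metis add_less_cancel_left atLeastLessThan_iff le_Suc_ex)
        with False have "t = k * n" by (cases r) auto
        then show ?thesis using \<open>r < n\<close> by (simp add: tdma_chan_in)
      qed (auto simp: tdma_chan_in)
      ultimately show ?thesis
        by (auto simp: Pair power_le_one)
    qed
    then have "(\<integral>\<^sup>+ x. ennreal (?f x) \<partial>?P) \<le> (\<integral>\<^sup>+ x. 1 \<partial>?P)"
      by (intro nn_integral_mono) (metis ennreal_1 ennreal_leI)
    then show ?thesis by (simp add: emeasure_space_1)
  qed
  show int: "integrable ?P ?f"
    using meas nonneg le by (intro integrableI_nonneg) (auto simp: top_unique less_top[symmetric])
  have "ennreal (\<integral>x. ?f x \<partial>?P) \<le> ennreal 1"
    using le nn_integral_eq_integral[OF int] nonneg by simp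
  then show "(\<integral>x. ?f x \<partial>?P) \<le> 1"
    by (subst (asm) ennreal_le_iff) simp_all
qed

lemma tdma_valid:
  assumes "1 \<le> T"
  shows "fb_code_valid K snr snr T C"
  unfolding fb_code_valid_def power_constraint_def
proof (intro conjI tdma_msgs tdma_measurable allI impI tdma_input_power(1))
  fix k assume k: "k < K"
  have "(\<Sum>t<T. \<integral>(w, z). (chan_in K snr snr C w z k t)\<^sup>2 \<partial>sample_space K T C) \<le> (\<Sum>t<T. 1)"
    using k by (intro sum_mono tdma_input_power(2)) simp_all
  then show "1 / real T * (\<Sum>t<T. \<integral>(w, z). (chan_in K snr snr C w z k t)\<^sup>2 \<partial>sample_space K T C) \<le> 1"
    using assms by (simp add: field_simps)
qed

text \<open>Rounding can fail only if the last noise of the turn, scaled by M / a^n, reaches 1 / 2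
  in absolute value. Chebyshev's inequality for this noise of variance 1 gives the bound, with a^(2
  n) = SNR^n.\<close>

lemma tdma_error_prob_le:
  assumes k: "k < K" and n: "1 \<le> n"
  shows "error_prob K snr snr T C k \<le> 4 * (real M)\<^sup>2 / snr ^ n"
proof -
  let ?P = "sample_space K T C"
  let ?j = "(k, k * n + (n - 1))"
  let ?c = "4 * (real M)\<^sup>2 / snr ^ n"
  interpret prob_space ?P by (rule prob_space_sample_space[OF tdma_msgs])
  define u where "u = (\<lambda>(w :: nat \<Rightarrow> nat, z :: nat \<times> nat \<Rightarrow> real). ennreal ((z ?j)\<^sup>2))"
  have j: "?j \<in> {..<K} \<times> {..<T}"
    using tdma_slot_less[OF k] n k by simp
  have a: "a > 0" "a\<^sup>2 = snr"
    using snr by (simp_all add: a_def)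
  have "u \<in> borel_measurable ?P"
    using tdma_msgs unfolding u_def
  proof (rule measurable_sample_space)
    fix w
    have "(\<lambda>z. z ?j) \<in> borel_measurable (noise_space K T)"
      unfolding measurable_cong_sets[OF sets_noise_space refl] by (rule measurable_PiM_lborel_component[OF j])
    then show "(\<lambda>z. case (w, z) of (w, z) \<Rightarrow> ennreal ((z ?j)\<^sup>2)) \<in> borel_measurable (noise_space K T)"
      by simp
  qed
  note [measurable] = this
  have "error_prob K snr snr T C k \<le> measure ?P {x \<in> space ?P. 1 \<le> ennreal ?c * u x}"
    unfolding error_prob_def
  proof (rule finite_measure_mono)
    show "{x \<in> space ?P. 1 \<le> ennreal ?c * u x} \<in> sets ?P"
      by measurable
    show "{(w, z) \<in> space ?P. dec C k (out_block K snr snr T C w z k) \<noteq> w k} \<subseteq> {x \<in> space ?P. 1 \<le> ennreal ?c * u x}"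
    proof clarify
      fix w z assume err: "dec C k (out_block K snr snr T C w z k) \<noteq> w k"
      \<comment> \<open>This is the deviation of the rescaled sum from the integer
        \<open>w k\<close>.\<close>
      define e where "e = real M * z ?j / a ^ n"
      have "fb_sum a (k * n) n (out_block K snr snr T C w z k) = a ^ n * (real (w k) / real M) + z ?j"
        using tdma_fb_sum[of k "n - 1" w z] k n tdma_slot_less[OF k] unfolding out_block_def
        by (simp add: fb_sum_restrict)
      then have dec: "dec C k (out_block K snr snr T C w z k) = nat \<lfloor>real (w k) + e + 1 / 2\<rfloor>"
        using a(1) M by (simp add: C_def tdma_code_def a_def[symmetric] e_def distrib_left add_divide_distrib)
      have "\<not> \<bar>e\<bar> < 1 / 2"
      proof
        assume "\<bar>e\<bar> < 1 / 2"
        then have "- 1 / 2 < e" "e < 1 / 2" by linarith+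
        then have "\<lfloor>real (w k) + e + 1 / 2\<rfloor> = int (w k)"
          by (simp add: floor_eq_iff)
        with err dec show False by simp
      qed
      then have "1 \<le> 4 * e\<^sup>2"
        using abs_le_square_iff[of "1 / 2" e] by (simp add: power2_eq_square)
      also have "4 * e\<^sup>2 = ?c * (z ?j)\<^sup>2"
        unfolding e_def a(2)[symmetric] by (simp add: power_mult_distrib power_divide flip: power_mult) (simp add: mult.commute)
      finally have "ennreal 1 \<le> ennreal (?c * (z ?j)\<^sup>2)"
        by (rule ennreal_leI)
      then show "1 \<le> ennreal ?c * u (w, z)"
        by (simp only: u_def prod.case ennreal_1 ennreal_mult''[OF zero_le_power2])
    qed
  qed
  also have "\<dots> \<le> ?c"
  proof -
    have "emeasure ?P {x \<in> space ?P. 1 \<le> ennreal ?c * u x} \<le> ennreal ?c * (\<integral>\<^sup>+ x. u x * indicator (space ?P) x \<partial>?P)"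
      by (intro nn_integral_Markov_inequality) simp_all
    also have "(\<integral>\<^sup>+ x. u x * indicator (space ?P) x \<partial>?P) = (\<integral>\<^sup>+ x. u x \<partial>?P)"
      by (intro nn_integral_cong) simp
    also have "\<dots> = 1"
      unfolding u_def by (rule nn_integral_noise_power[OF tdma_msgs j])
    finally show ?thesis
      using snr unfolding measure_def by (intro enn2real_leI) simp_all
  qed
  finally show ?thesis .
qed

end

text \<open>With about T / K slots per user, the bound M^2 / SNR^n is of order \<open>q ^ T\<close>,
  and the condition on \<open>R\<close> says exactly that \<open>q < 1\<close>.\<close>

lemma achievable_below_dof:
  assumes K: "0 < K" and snr: "1 < snr" and R: "0 \<le> R" "R < log 2 snr / (2 * real K)"
  shows "achievable K snr snr (\<lambda>_. R)"
proof -
  define M where "M T = nat \<lceil>2 powr (real T * R)\<rceil>" for T :: nat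
  define C where "C T = tdma_code (sqrt snr) (T div K) (M T)" for T
  have snr0: "0 < snr" using snr by simp
  have M_ge: "2 powr (real T * R) \<le> real (M T)" for T
    unfolding M_def by (rule real_nat_ceiling_ge)
  have M1: "1 \<le> M T" for T
    unfolding M_def by (simp add: Suc_le_eq)
  \<comment> \<open>Rounding up costs at most a factor 2, since \<open>0 \<le> R\<close> makes the
    power at least 1.\<close>
  have M_le: "real (M T) \<le> 2 * 2 powr (real T * R)" for T
  proof -
    have "real (M T) \<le> 2 powr (real T * R) + 1"
      unfolding M_def by (simp add: of_nat_nat)
    moreover have "1 \<le> 2 powr (real T * R)"
      using R by (simp add: ge_one_powr_ge_zero)
    ultimately show ?thesis by simp
  qed
  have nT: "T div K * K \<le> T" for T
    by (rule div_times_less_eq_dividend)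
  define q where "q = 2 powr (2 * R) / snr powr (1 / real K)"
  have "2 * R < log 2 (snr powr (1 / real K))"
    using R K snr0 by (simp add: log_powr field_simps)
  then have q: "0 \<le> q" "q < 1"
    using snr0 by (simp_all add: q_def less_log_iff)
  \<comment> \<open>For \<open>T < K\<close> the turns are empty, so the bound starts at
    \<open>K\<close>. The factor \<open>snr\<close> pays for rounding T / K down, and 16 is 4 times
    the square of the factor 2 in \<open>M_le\<close>.\<close>
  have bound: "error_prob K snr snr T (C T) k \<le> 16 * snr * q ^ T" if T: "K \<le> T" and k: "k < K" for T k
  proof -
    have "1 \<le> T div K"
      using T K by (simp add: div_greater_zero_iff Suc_le_eq)
    then have "error_prob K snr snr T (C T) k \<le> 4 * (real (M T))\<^sup>2 / snr ^ (T div K)"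
      unfolding C_def by (intro tdma_error_prob_le nT M1 snr0 k)
    also have "\<dots> \<le> 4 * (2 * 2 powr (real T * R))\<^sup>2 / snr ^ (T div K)"
      using M_le snr0 by (intro divide_right_mono mult_left_mono power_mono) auto
    also have "\<dots> \<le> 4 * (2 * 2 powr (real T * R))\<^sup>2 / snr powr (real T / real K - 1)"
    proof (intro divide_left_mono)
      have "real T / real K - 1 \<le> real (T div K)"
      proof -
        have "T < K * (T div K) + K"
          using mult_div_mod_eq[of K T] mod_less_divisor[OF K, of T] by linarith
        then have "real T < real K * (real (T div K) + 1)"
          by (simp add: distrib_left flip: of_nat_mult of_nat_add)
        then show ?thesis using K by (simp add: field_simps)
      qed
      then show "snr powr (real T / real K - 1) \<le> snr ^ (T div K)"
        using snr by (simp flip: powr_realpow)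
    qed (use snr0 in auto)
    also have "\<dots> = 16 * snr * q ^ T"
    proof -
      have "(2 powr (real T * R))\<^sup>2 = (2 powr (2 * R)) ^ T"
        by (simp add: powr_power mult_ac)
      moreover have "snr powr (real T / real K - 1) = (snr powr (1 / real K)) ^ T / snr"
        using snr0 by (simp add: powr_diff powr_power)
      ultimately show ?thesis
        using snr0 by (simp add: q_def power_mult_distrib power_divide)
    qed
    finally show ?thesis .
  qed
  have "(\<lambda>T. error_prob K snr snr T (C T) k) \<longlonglongrightarrow> 0" if k: "k < K" for k
  proof (rule tendsto_sandwich)
    show "\<forall>\<^sub>F T in sequentially. 0 \<le> error_prob K snr snr T (C T) k"
      by (simp add: error_prob_def)
    show "\<forall>\<^sub>F T in sequentially. error_prob K snr snr T (C T) k \<le> 16 * snr * q ^ T"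
      using bound k by (auto simp: eventually_sequentially)
    show "(\<lambda>T. 16 * snr * q ^ T) \<longlonglongrightarrow> 0"
      using q by (intro tendsto_mult_right_zero LIMSEQ_power_zero) simp
  qed simp
  moreover have "fb_code_valid K snr snr T (C T)" if "1 \<le> T" for T
    unfolding C_def by (rule tdma_valid[OF nT M1 snr0 that])
  ultimately show ?thesis
    unfolding achievable_def using M_ge by (intro exI[of _ C]) (simp add: C_def)
qed

section \<open>Degrees of freedom\<close>

lemma R_sym_le:
  assumes "0 < K" "0 < snr"
  shows "R_sym K snr snr
    \<le> ereal (log 2 (sqrt (exp 1 * (4 * (snr * (real K)\<^sup>2 + 1))) * sqrt (2 * real K + 2) ^ (K - 1)) / real K)"
  unfolding R_sym_def
proof (rule Sup_least, clarify)
  fix R assume "achievable K snr snr (\<lambda>_. R)"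
  from achievable_rate_le[OF assms this]
  show "ereal R \<le> ereal (log 2 (sqrt (exp 1 * (4 * (snr * (real K)\<^sup>2 + 1))) * sqrt (2 * real K + 2) ^ (K - 1)) / real K)"
    using assms(1) by (simp add: field_simps)
qed

lemma R_sym_ge:
  assumes K: "0 < K" and snr: "1 < snr"
  shows "ereal (log 2 snr / (2 * real K)) \<le> R_sym K snr snr"
proof (rule ereal_le_epsilon2)
  fix e :: real assume e: "0 < e"
  let ?c = "log 2 snr / (2 * real K)"
  \<comment> \<open>The rate \<open>?c\<close> is approached from below because
    \<open>achievable_below_dof\<close> is strict; the maximum with 0 keeps the rate
    nonnegative.\<close>
  define R where "R = max 0 (?c - e)"
  have "0 < ?c" using K snr by simp
  then have "achievable K snr snr (\<lambda>_. R)"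
    using e by (intro achievable_below_dof K snr) (auto simp: R_def)
  then have "ereal R \<le> R_sym K snr snr"
    unfolding R_sym_def by (intro Sup_upper) auto
  then have "ereal R + ereal e \<le> R_sym K snr snr + ereal e"
    by (rule add_right_mono)
  moreover have "ereal ?c \<le> ereal R + ereal e"
  proof -
    have "?c \<le> R + e" by (simp add: R_def)
    then show ?thesis by (simp only: plus_ereal.simps ereal_less_eq)
  qed
  ultimately show "ereal ?c \<le> R_sym K snr snr + ereal e"
    by (rule order.trans[rotated])
qed

text \<open>For \<open>snr\<close> at least 1, replacing the summand 1 by \<open>snr\<close> makes
  \<open>snr\<close> a common factor, so the logarithm splits into half of log SNR and a constant
  depending on \<open>K\<close> alone.\<close>

lemma R_sym_le_linear:
  assumes K: "0 < K" and snr: "1 \<le> snr"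
  shows "R_sym K snr snr \<le> ereal ((1 / 2 * log 2 snr
    + log 2 (sqrt (exp 1 * (4 * ((real K)\<^sup>2 + 1))) * sqrt (2 * real K + 2) ^ (K - 1))) / real K)"
proof -
  define d where "d = sqrt (2 * real K + 2) ^ (K - 1)"
  define A where "A = exp 1 * (4 * ((real K)\<^sup>2 + 1))"
  have d: "d > 0" by (simp add: d_def)
  have A: "A > 0" by (simp add: A_def add_nonneg_pos)
  have "exp 1 * (4 * (snr * (real K)\<^sup>2 + 1)) \<le> snr * A"
    using snr by (simp add: A_def algebra_simps)
  then have "sqrt (exp 1 * (4 * (snr * (real K)\<^sup>2 + 1))) * d \<le> sqrt (snr * A) * d"
    using d by (intro mult_right_mono real_sqrt_le_mono) simp_all
  moreover have "0 < sqrt (exp 1 * (4 * (snr * (real K)\<^sup>2 + 1))) * d"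
    using d snr by (simp add: add_nonneg_pos)
  ultimately have "log 2 (sqrt (exp 1 * (4 * (snr * (real K)\<^sup>2 + 1))) * d) \<le> log 2 (sqrt (snr * A) * d)"
    by (subst log_le_cancel_iff) simp_all
  also have "\<dots> = log 2 (sqrt snr) + log 2 (sqrt A * d)"
    using snr A d by (simp add: real_sqrt_mult mult.assoc log_mult_pos)
  also have "log 2 (sqrt snr) = 1 / 2 * log 2 snr"
    using snr by (simp add: powr_half_sqrt[symmetric] log_powr)
  finally have "log 2 (sqrt (exp 1 * (4 * (snr * (real K)\<^sup>2 + 1))) * d) / real K \<le> (1 / 2 * log 2 snr + log 2 (sqrt A * d)) / real K"
    using K by (intro divide_right_mono) simp_all
  with R_sym_le[OF K, of snr] snr show ?thesis
    unfolding d_def A_def by (simp add: order.trans)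
qed

theorem mainTheorem2:
  fixes K :: nat
  assumes "K \<ge> 2"
  shows "Limsup at_top (\<lambda>SNR :: real. R_sym K SNR SNR / ereal (1 / 2 * log 2 SNR)) = ereal (1 / real K)"
proof (rule antisym)
  have K: "0 < K" using assms by simp
  define c where "c = log 2 (sqrt (exp 1 * (4 * ((real K)\<^sup>2 + 1))) * sqrt (2 * real K + 2) ^ (K - 1))"
  have le: "R_sym K s s / ereal (1 / 2 * log 2 s) \<le> ereal (1 / real K + 2 * c / real K / log 2 s)" if "1 < s" for s
  proof -
    have l: "0 < log 2 s" using that by simp
    have "R_sym K s s / ereal (1 / 2 * log 2 s) \<le> ereal ((1 / 2 * log 2 s + c) / real K) / ereal (1 / 2 * log 2 s)"
      using R_sym_le_linear[OF K, of s] that l unfolding c_def by (intro ereal_divide_right_mono) simp_all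
    also have "\<dots> = ereal ((1 / 2 * log 2 s + c) / real K / (1 / 2 * log 2 s))"
      using l by simp
    also have "(1 / 2 * log 2 s + c) / real K / (1 / 2 * log 2 s) = 1 / real K + 2 * c / real K / log 2 s"
      using l K by (simp add: field_simps)
    finally show ?thesis .
  qed
  \<comment> \<open>The constant loss \<open>c\<close> is divided by a growing logarithm and
    disappears.\<close>
  have "((\<lambda>s. 1 / real K + 2 * c / real K / log 2 s) \<longlongrightarrow> 1 / real K + 0) at_top"
  proof (intro tendsto_add tendsto_const tendsto_divide_0[OF tendsto_const] filterlim_at_top_imp_at_infinity)
    show "filterlim (\<lambda>s. log 2 s :: real) at_top at_top"
      unfolding log_def divide_inverse
      by (rule filterlim_at_top_mult_tendsto_pos[OF tendsto_const _ ln_at_top]) simp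
  qed
  then have lim: "((\<lambda>s. ereal (1 / real K + 2 * c / real K / log 2 s)) \<longlongrightarrow> ereal (1 / real K)) at_top"
    by simp
  have "Limsup at_top (\<lambda>s. R_sym K s s / ereal (1 / 2 * log 2 s))
      \<le> Limsup at_top (\<lambda>s. ereal (1 / real K + 2 * c / real K / log 2 s))"
    using le by (intro Limsup_mono eventually_mono[OF eventually_gt_at_top[of 1]])
  also have "\<dots> = ereal (1 / real K)"
    using lim by (intro lim_imp_Limsup) simp_all
  finally show "Limsup at_top (\<lambda>s. R_sym K s s / ereal (1 / 2 * log 2 s)) \<le> ereal (1 / real K)" .
  \<comment> \<open>The lower bound holds at every \<open>s > 1\<close>, without passing to a limit,
    so the limit superior is in fact a limit.\<close>
  have "ereal (1 / real K) \<le> R_sym K s s / ereal (1 / 2 * log 2 s)" if "1 < s" for s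
  proof -
    have l: "0 < log 2 s" using that by simp
    have "1 / real K = log 2 s / (2 * real K) / (1 / 2 * log 2 s)"
      using l K by (simp add: field_simps)
    then have "ereal (1 / real K) = ereal (log 2 s / (2 * real K)) / ereal (1 / 2 * log 2 s)"
      using l by simp
    also have "\<dots> \<le> R_sym K s s / ereal (1 / 2 * log 2 s)"
      using R_sym_ge[OF K that] l by (intro ereal_divide_right_mono) simp_all
    finally show ?thesis .
  qed
  then have "Limsup at_top (\<lambda>_::real. ereal (1 / real K)) \<le> Limsup at_top (\<lambda>s. R_sym K s s / ereal (1 / 2 * log 2 s))"
    by (intro Limsup_mono eventually_mono[OF eventually_gt_at_top[of 1]])
  then show "ereal (1 / real K) \<le> Limsup at_top (\<lambda>s. R_sym K s s / ereal (1 / 2 * log 2 s))"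
    by (simp add: Limsup_const)
qed

end
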